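(* Consider the model $Y_i=f_0(x_i)+\varepsilon_i$, $i=1,\dots,n$, with $\varepsilon_i$ i.i.d. $\mathcal N(0,1)$ and $x_i=i/n$. Let $f_0:[0,1]\to\mathbb R$ be a step function with $K_0$ steps, where $K_0$ is unknown, with vector of step heights $\boldsymbol\beta^0=(\beta^0_1,\dots,\beta^0_{K_0})'$, and suppose that $f_0$ can be written as a step function supported on some partition in the class $\boldsymbol\Omega^{BI}$ of balanced interval partitions. Let $\mathcal F$ be the set of all step functions supported on balanced intervals, equipped with the prior $\Pi$ under which (i) the number of cells $K$ satisfies $\Pi(K=k)\propto \exp(-c_K\,k\log k)$, $k=1,2,\dots$, where $c_K>0$ is a fixed constant; (ii) given $K$, the partition is uniformly distributed on the finite set $\boldsymbol\Omega^{BI}_K$ of balanced partitions with $K$ cells; and (iii) given $K$ and the partition, the step heights $\beta_1,\dots,\beta_K$ are independent standard normal. Write $K_{f_0}= K(f_0,\boldsymbol\Omega^{BI})$ for the complexity of $f_0$ with respect to $\boldsymbol\Omega^{BI}$. Let $\beta>1/2$ be a constant and assume $\|\boldsymbol\beta^0\|_\infty^2\lesssim \log^{2\beta} n$ and $K_{f_0}\lesssim\sqrt n$. Then, for every sequence $M_n\to\infty$ as $n\to\infty$, $$\Pi\left(f\in\mathcal F:\ \|f-f_0\|_n\ \ge\ M_n\, n^{-1/2}\sqrt{K_{f_0}\log^{2\beta}(n/K_{f_0})}\ \Big|\ \boldsymbol Y^{(n)}\right)\longrightarrow 0$$ in $P_{f_0}^n$-probability as $n\to\infty$.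
   Context: **Model and norms.** The covariates $x_i=i/n$ are fixed. $\boldsymbol Y^{(n)}=(Y_1,\dots,Y_n)'$. $P_f^n$ denotes the joint law of the $n$ independent observations when the regression function is $f$. $\|g\|_n^2=\frac1n\sum_{i=1}^n g(x_i)^2$. The notation $a\lesssim b$ means $a\le Cb$ for a constant $C$ not depending on $n$; $\propto$ means equality up to a normalizing constant; $\log^{2\beta}t=(\log t)^{2\beta}$. $\|\boldsymbol\beta^0\|_\infty=\max_k|\beta_k^0|$ (the scalar exponent $\beta$ is unrelated to the step heights). $\Pi(\cdot\mid\boldsymbol Y^{(n)})$ is the posterior distribution obtained from the prior $\Pi$ and the Gaussian likelihood of the model. **True function.** $f_0(x)=\sum_{k=1}^{K_0}\beta_k^0\,\mathbb I_{\Omega_k^0}(x)$, where $\{\Omega_k^0\}_{k=1}^{K_0}$ is a partition of $[0,1]$ into $K_0$ non-overlapping intervals which is minimal, i.e. $f_0$ cannot be represented with a partition having fewer than $K_0$ pieces. The function $f_0$, and hence $K_0$, $\boldsymbol\beta^0$ and $K_{f_0}$, may depend on $n$. **Balanced intervals.** For an interval $\Omega_k$ let $\mu(\Omega_k)=\frac1n\sum_{i=1}^n\mathbb I(x_i\in\Omega_k)$. Fix universal constants $0<C_{\min}\le1\le C_{\max}$ not depending on $K$ (or $n$). A partition $\{\Omega_k\}_{k=1}^K$ is balanced if $\frac{C_{\min}^2}{K}\le\mu(\Omega_k)\le\frac{C_{\max}^2}{K}$ for all $k=1,\dots,K$. The partitions considered have split points at observed values: given distinct $u_1,\dots,u_{K-1}\in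 I_n=\{x_i:i=1,\dots,n-1\}$ with order statistics $u_{(1)}<\dots<u_{(K-1)}$, and $u_{(0)}=0$, $u_{(K)}=1$, the cells are $\Omega_k=(u_{(k-1)},u_{(k)}]$, $k=1,\dots,K$. $\boldsymbol\Omega^{BI}_K$ is the set of all such balanced partitions with $K$ cells, and $\boldsymbol\Omega^{BI}=\bigcup_{K\ge1}\boldsymbol\Omega_K^{BI}$. The prior on $K$ is understood as restricted to those $K$ for which $\boldsymbol\Omega_K^{BI}$ is nonempty. (Whether the point $0$ is included in the first cell is immaterial.) **Space of functions.** $\mathcal F=\bigcup_{K=1}^\infty\mathcal F_K$, where $\mathcal F_K$ is the set of functions $f_{\boldsymbol\beta}(x)=\sum_{k=1}^K\beta_k\mathbb I_{\Omega_k}(x)$ with $\boldsymbol\beta\in\mathbb R^K$ and $\{\Omega_k\}_{k=1}^K\in\boldsymbol\Omega_K^{BI}$. **Complexity.** For an interval $V\subset[0,1]$ let $m(V;\{\Omega^0_k\}_{k=1}^{K_0})$ be the number of cells $\Omega_k^0$ with $\Omega_k^0\cap V\ne\emptyset$. For a class of partitions $\boldsymbol\Omega$, the complexity $K(f_0,\boldsymbol\Omega)$ is the smallest $K$ such that there is a partition $\{\Omega_k\}_{k=1}^K$ in $\boldsymbol\Omega$ with $K$ cells for which $m(\Omega_k;\{\Omega_j^0\}_{j=1}^{K_0})=1$ for all $k=1,\dots,K$. *)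

theory Defs
  imports "HOL-Probability.Probability"
begin

section \<open>Step functions and interval partitions\<close>

text \<open>A partition is the list of its cells; the step heights are a function of the
  cell's position, of which only the values below the number of cells matter.\<close>

definition step_fun :: "real set list \<Rightarrow> (nat \<Rightarrow> real) \<Rightarrow> real \<Rightarrow> real" where
  "step_fun P b x = (\<Sum>k<length P. b k * indicator (P ! k) x)"

definition interval_partition :: "real set list \<Rightarrow> bool" where
  "interval_partition P \<longleftrightarrow>
     distinct P \<and> partition_on {0..1} (set P) \<and> (\<forall>V\<in>set P. is_interval V)"

definition represents :: "real set list \<Rightarrow> (nat \<Rightarrow> real) \<Rightarrow> (real \<Rightarrow> real) \<Rightarrow> bool" where
  "represents P b f \<longleftrightarrow> interval_partition P \<and> (\<forall>x\<in>{0..1}. f x = step_fun P b x)"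

definition minimal_representation :: "real set list \<Rightarrow> (nat \<Rightarrow> real) \<Rightarrow> (real \<Rightarrow> real) \<Rightarrow> bool" where
  "minimal_representation P b f \<longleftrightarrow>
     represents P b f \<and> (\<forall>P' b'. represents P' b' f \<longrightarrow> length P \<le> length P')"

definition sup_norm :: "nat \<Rightarrow> (nat \<Rightarrow> real) \<Rightarrow> real" where
  "sup_norm K b = Max ((\<lambda>k. \<bar>b k\<bar>) ` {..<K})"

section \<open>Balanced interval partitions\<close>

definition design :: "nat \<Rightarrow> nat \<Rightarrow> real" where
  "design n i = real i / real n"

definition split_candidates :: "nat \<Rightarrow> real set" where
  "split_candidates n = design n ` {1..<n}"

definition cell_mass :: "nat \<Rightarrow> real set \<Rightarrow> real" where
  "cell_mass n V = (\<Sum>i=1..n. indicator V (design n i)) / real n"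

definition balanced :: "nat \<Rightarrow> real \<Rightarrow> real \<Rightarrow> real set list \<Rightarrow> bool" where
  "balanced n Cmin Cmax P \<longleftrightarrow>
     (\<forall>V\<in>set P. Cmin\<^sup>2 / real (length P) \<le> cell_mass n V \<and>
                cell_mass n V \<le> Cmax\<^sup>2 / real (length P))"

text \<open>The cells cut out of \<open>(0,1]\<close> by a finite set of interior split points, from left to right.\<close>

definition cells :: "real set \<Rightarrow> real set list" where
  "cells U = (let u = 0 # sorted_list_of_set U @ [1]
              in map (\<lambda>k. {u ! k <.. u ! Suc k}) [0..<Suc (card U)])"

definition BI_K :: "nat \<Rightarrow> real \<Rightarrow> real \<Rightarrow> nat \<Rightarrow> real set list set" where
  "BI_K n Cmin Cmax K =
     {cells U |U. U \<subseteq> split_candidates n \<and> Suc (card U) = K \<and> balanced n Cmin Cmax (cells U)}"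

definition BI :: "nat \<Rightarrow> real \<Rightarrow> real \<Rightarrow> real set list set" where
  "BI n Cmin Cmax = (\<Union>K\<in>{1..}. BI_K n Cmin Cmax K)"

definition step_class :: "nat \<Rightarrow> real \<Rightarrow> real \<Rightarrow> (real \<Rightarrow> real) set" where
  "step_class n Cmin Cmax = {step_fun P b |P b. P \<in> BI n Cmin Cmax}"

text \<open>Balanced cells cover only \<open>(0,1]\<close>, while the partition of the true function covers
  \<open>[0,1]\<close>; the value at \<open>0\<close>, which is not a design point, is therefore left free here.\<close>

definition supported_on_class :: "real set list set \<Rightarrow> (real \<Rightarrow> real) \<Rightarrow> bool" where
  "supported_on_class \<O> f \<longleftrightarrow> (\<exists>P\<in>\<O>. \<exists>b. \<forall>x\<in>{0<..1}. f x = step_fun P b x)"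

section \<open>Complexity\<close>

definition num_met :: "real set \<Rightarrow> real set list \<Rightarrow> nat" where
  "num_met V P0 = card {j. j < length P0 \<and> P0 ! j \<inter> V \<noteq> {}}"

definition complexity :: "real set list \<Rightarrow> real set list set \<Rightarrow> nat" where
  "complexity P0 \<O> = (LEAST K. \<exists>P\<in>\<O>. length P = K \<and> (\<forall>V\<in>set P. num_met V P0 = 1))"

section \<open>Model, prior and posterior\<close>

definition emp_norm :: "nat \<Rightarrow> (real \<Rightarrow> real) \<Rightarrow> real" where
  "emp_norm n g = sqrt ((\<Sum>i=1..n. (g (design n i))\<^sup>2) / real n)"

definition data_law :: "nat \<Rightarrow> (real \<Rightarrow> real) \<Rightarrow> (nat \<Rightarrow> real) measure" where
  "data_law n f = (\<Pi>\<^sub>M i\<in>{1..n}. density lborel (\<lambda>y. ennreal (normal_density (f (design n i)) 1 y)))"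

definition likelihood :: "nat \<Rightarrow> (real \<Rightarrow> real) \<Rightarrow> (nat \<Rightarrow> real) \<Rightarrow> real" where
  "likelihood n f y = (\<Prod>i=1..n. normal_density (f (design n i)) 1 (y i))"

text \<open>The underlying set is exactly the class of step functions, and the sigma-algebra is the
  trace of the one generated by point evaluations.  (The class itself is not measurable in the
  uncountable product, so it has to be the whole space here.)\<close>

definition step_space :: "nat \<Rightarrow> real \<Rightarrow> real \<Rightarrow> (real \<Rightarrow> real) measure" where
  "step_space n Cmin Cmax = restrict_space (\<Pi>\<^sub>M x\<in>UNIV. borel) (step_class n Cmin Cmax)"

definition admissible_K :: "nat \<Rightarrow> real \<Rightarrow> real \<Rightarrow> nat set" where
  "admissible_K n Cmin Cmax = {K\<in>{1..}. BI_K n Cmin Cmax K \<noteq> {}}"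

definition K_weight :: "real \<Rightarrow> nat \<Rightarrow> real" where
  "K_weight cK k = exp (- cK * real k * ln (real k))"

text \<open>Only finitely many (at most \<open>n\<close>) values of \<open>K\<close> are admissible, so the normalizing sum is finite.\<close>

definition K_prior :: "nat \<Rightarrow> real \<Rightarrow> real \<Rightarrow> real \<Rightarrow> nat measure" where
  "K_prior n Cmin Cmax cK =
     point_measure (admissible_K n Cmin Cmax)
       (\<lambda>k. ennreal (K_weight cK k / (\<Sum>j\<in>admissible_K n Cmin Cmax. K_weight cK j)))"

definition heights_prior :: "nat \<Rightarrow> (nat \<Rightarrow> real) measure" where
  "heights_prior K = (\<Pi>\<^sub>M k\<in>{..<K}. density lborel (\<lambda>t. ennreal (std_normal_density t)))"

definition prior :: "nat \<Rightarrow> real \<Rightarrow> real \<Rightarrow> real \<Rightarrow> (real \<Rightarrow> real) measure" where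
  "prior n Cmin Cmax cK =
     K_prior n Cmin Cmax cK \<bind> (\<lambda>K.
       uniform_count_measure (BI_K n Cmin Cmax K) \<bind> (\<lambda>P.
         distr (heights_prior K) (step_space n Cmin Cmax) (step_fun P)))"

definition posterior ::
  "nat \<Rightarrow> real \<Rightarrow> real \<Rightarrow> real \<Rightarrow> (nat \<Rightarrow> real) \<Rightarrow> (real \<Rightarrow> real) measure" where
  "posterior n Cmin Cmax cK y =
     density (prior n Cmin Cmax cK)
       (\<lambda>f. ennreal (likelihood n f y) /
            (\<integral>\<^sup>+ g. ennreal (likelihood n g y) \<partial>prior n Cmin Cmax cK))"

end

theory Submission
  imports Defs "HOL-Real_Asymp.Real_Asymp"
begin

text \<open>
  Write \<open>K\<^sub>0\<close> for the complexity of the truth and \<open>G = K\<^sub>0 * (ln n) powr (2 * \<beta>)\<close>; since \<open>K\<^sub>0\<close> is of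
  order at most \<open>sqrt n\<close>, the squared rate in the theorem is of order \<open>M\<^sup>2 * G / n\<close>. All likelihoods are
  divided by the likelihood at the truth, and the posterior mass of the functions far from the truth
  is a quotient of two integrals of likelihood ratios with respect to the prior.

  \<^emph>\<open>Regular noise.\<close> The sum of the noise over any interval between design points is at most
  \<open>sqrt (6 * ln n)\<close> times its standard deviation, simultaneously for all such intervals, with
  probability tending to one (lemma \<open>measure_not_regular_noise\<close>). There are only \<open>(n + 1)\<^sup>2\<close> such
  intervals, and every cell of every partition is one of them.

  \<^emph>\<open>Denominator.\<close> The complexity is attained by a balanced partition on which the truth is a step
  function with heights bounded by those of its minimal representation
  (\<open>complexity_attained\<close>). Heights close to the true ones on this partition contribute at least
  \<open>exp (- C1 * G)\<close> on the regular event (\<open>evidence_lower\<close>, \<open>evidence_bound_ge\<close>); the assumption on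
  the size of the true heights is needed because the prior on the heights is centred at zero.

  \<^emph>\<open>Numerator, few cells.\<close> On the regular event a function with \<open>K\<close> cells at empirical distance
  \<open>\<rho>\<close> from the truth has a likelihood ratio of at most
  \<open>exp (6 * ln n * (K + K\<^sub>0) - n * \<rho>\<^sup>2 / 4)\<close> (\<open>lik_ratio_upper\<close>). For \<open>K\<close> up to a constant times
  \<open>G / ln n\<close> and \<open>n * \<rho>\<^sup>2\<close> of order \<open>M\<^sup>2 * G\<close> this is negligible compared with the denominator.

  \<^emph>\<open>Numerator, many cells.\<close> The prior on \<open>K\<close> alone does not exclude more than \<open>G / ln n\<close> cells:
  if \<open>K\<^sub>0\<close> is bounded, \<open>K = G / ln n\<close> is of the order of a power of \<open>ln n\<close>, and \<open>K * ln K\<close> is of smaller order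
  than \<open>G\<close>. What helps is that integrating out the heights penalizes dimension, as in the Bayesian
  information criterion. On the regular event the expected marginal likelihood ratio of a partition
  is at most the product of \<open>sqrt (6 * ln n / m)\<close> over its cells, \<open>m\<close> being the number of design
  points in the cell (\<open>expected_marginal_on_regular_noise\<close>). For balanced partitions \<open>m\<close> is at
  least of order \<open>n / K\<close>, and this factor combined with the prior on \<open>K\<close> is
  \<open>exp (- c * K * ln n)\<close> for all \<open>K\<close> (\<open>overfit_penalty\<close>). Because expectations suffice here, no
  union bound over partitions is needed.
\<close>

section \<open>Likelihood ratios in the Gaussian sequence model\<close>

abbreviation gauss :: "real \<Rightarrow> real measure" where
  "gauss a \<equiv> density lborel (\<lambda>t. ennreal (normal_density a 1 t))"

lemma prob_space_data_law: "prob_space (data_law n f)"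
  unfolding data_law_def by (intro prob_space_PiM prob_space_normal_density) auto

lemma sets_data_law [measurable_cong]: "sets (data_law n f) = sets (\<Pi>\<^sub>M i\<in>{1..n}. borel)"
  unfolding data_law_def by (intro sets_PiM_cong) auto

lemma space_data_law: "space (data_law n f) = {1..n} \<rightarrow>\<^sub>E UNIV"
  by (simp add: data_law_def space_PiM)

text \<open>Every likelihood is compared with the one at the truth. In terms of the noise
  \<open>y i - f0 (design n i)\<close> the Gaussian likelihood ratio is the exponential of a linear term minus
  half of the squared distance of the two regression vectors.\<close>

definition lik_ratio :: "nat \<Rightarrow> (real \<Rightarrow> real) \<Rightarrow> (real \<Rightarrow> real) \<Rightarrow> (nat \<Rightarrow> real) \<Rightarrow> real" where
  "lik_ratio n f0 f y =
     exp ((\<Sum>i=1..n. (f (design n i) - f0 (design n i)) * (y i - f0 (design n i)))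
        - (\<Sum>i=1..n. (f (design n i) - f0 (design n i))\<^sup>2) / 2)"

lemma lik_ratio_pos: "0 < lik_ratio n f0 f y"
  by (simp add: lik_ratio_def)

lemma likelihood_pos: "0 < likelihood n f y"
  by (auto simp: likelihood_def intro!: prod_pos normal_density_pos)

lemma likelihood_eq_lik_ratio: "likelihood n f y = likelihood n f0 y * lik_ratio n f0 f y"
proof -
  have "normal_density a 1 t = normal_density b 1 t * exp ((a - b) * (t - b) - (a - b)\<^sup>2 / 2)"
    for a b t :: real
    by (simp add: normal_density_def exp_add[symmetric] power2_eq_square field_simps)
  hence "likelihood n f y = (\<Prod>i=1..n. normal_density (f0 (design n i)) 1 (y i) *
      exp ((f (design n i) - f0 (design n i)) * (y i - f0 (design n i))
           - (f (design n i) - f0 (design n i))\<^sup>2 / 2))"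
    unfolding likelihood_def by (intro prod.cong) auto
  thus ?thesis
    by (simp add: likelihood_def lik_ratio_def prod.distrib exp_sum[symmetric] sum_subtractf
        sum_divide_distrib)
qed

lemma likelihood_measurable [measurable]:
  "likelihood n f \<in> borel_measurable (\<Pi>\<^sub>M i\<in>{1..n}. borel)"
  unfolding likelihood_def by measurable

lemma lik_ratio_measurable [measurable]:
  "lik_ratio n f0 f \<in> borel_measurable (\<Pi>\<^sub>M i\<in>{1..n}. borel)"
  unfolding lik_ratio_def by measurable

lemma data_law_eq_density:
  "data_law n f = density (\<Pi>\<^sub>M i\<in>{1..n}. lborel) (\<lambda>y. ennreal (likelihood n f y))"
proof -
  interpret L: product_sigma_finite "\<lambda>i::nat. lborel :: real measure"
    by standard
  interpret G: product_sigma_finite "\<lambda>i. gauss (f (design n i))"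
    by (intro product_sigma_finite.intro prob_space_imp_sigma_finite prob_space_normal_density) auto
  have [measurable_cong]:
    "sets (\<Pi>\<^sub>M i\<in>{1..n}. (lborel :: real measure)) = sets (\<Pi>\<^sub>M i\<in>{1..n}. borel)"
    by (intro sets_PiM_cong) auto
  show ?thesis
    unfolding data_law_def
  proof (rule G.PiM_eqI[symmetric])
    show "sets (density (\<Pi>\<^sub>M i\<in>{1..n}. lborel) (\<lambda>y. ennreal (likelihood n f y))) =
      sets (\<Pi>\<^sub>M i\<in>{1..n}. gauss (f (design n i)))"
      unfolding sets_density by (intro sets_PiM_cong) auto
    fix A assume A: "\<And>i. i \<in> {1..n} \<Longrightarrow> A i \<in> sets (gauss (f (design n i)))"
    have PiA: "Pi\<^sub>E {1..n} A \<in> sets (\<Pi>\<^sub>M i\<in>{1..n}. lborel)"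
      using A by (intro sets_PiM_I_finite) auto
    have "emeasure (density (\<Pi>\<^sub>M i\<in>{1..n}. lborel) (\<lambda>y. ennreal (likelihood n f y))) (Pi\<^sub>E {1..n} A)
      = (\<integral>\<^sup>+y. ennreal (likelihood n f y) * indicator (Pi\<^sub>E {1..n} A) y \<partial>(\<Pi>\<^sub>M i\<in>{1..n}. lborel))"
      by (rule emeasure_density[OF _ PiA]) measurable
    also have "\<dots> = (\<integral>\<^sup>+y. (\<Prod>i\<in>{1..n}. ennreal (normal_density (f (design n i)) 1 (y i)) * indicator (A i) (y i))
        \<partial>(\<Pi>\<^sub>M i\<in>{1..n}. lborel))"
    proof (rule nn_integral_cong)
      fix y assume y: "y \<in> space (\<Pi>\<^sub>M i\<in>{1..n}. (lborel :: real measure))"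
      have "indicator (Pi\<^sub>E {1..n} A) y = (\<Prod>i\<in>{1..n}. indicator (A i) (y i) :: ennreal)"
        using y by (auto simp: indicator_def PiE_iff space_PiM prod_ennreal)
      thus "ennreal (likelihood n f y) * indicator (Pi\<^sub>E {1..n} A) y =
        (\<Prod>i\<in>{1..n}. ennreal (normal_density (f (design n i)) 1 (y i)) * indicator (A i) (y i))"
        by (simp add: likelihood_def prod_ennreal prod.distrib)
    qed
    also have "\<dots> = (\<Prod>i\<in>{1..n}. emeasure (gauss (f (design n i))) (A i))"
    proof (subst L.product_nn_integral_prod)
      show "(\<lambda>t. ennreal (normal_density (f (design n i)) 1 t) * indicator (A i) t) \<in> borel_measurable lborel"
        if "i \<in> {1..n}" for i using A[OF that] by auto
    qed (use A in \<open>auto intro!: prod.cong simp: emeasure_density\<close>)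
    finally show "emeasure (density (\<Pi>\<^sub>M i\<in>{1..n}. lborel) (\<lambda>y. ennreal (likelihood n f y))) (Pi\<^sub>E {1..n} A)
      = (\<Prod>i\<in>{1..n}. emeasure (gauss (f (design n i))) (A i))" .
  qed auto
qed

lemma data_law_change_of_measure:
  "data_law n f = density (data_law n f0) (\<lambda>y. ennreal (lik_ratio n f0 f y))"
proof -
  have [measurable_cong]:
    "sets (\<Pi>\<^sub>M i\<in>{1..n}. (lborel :: real measure)) = sets (\<Pi>\<^sub>M i\<in>{1..n}. borel)"
    by (intro sets_PiM_cong) auto
  have "density (data_law n f0) (\<lambda>y. ennreal (lik_ratio n f0 f y)) =
    density (\<Pi>\<^sub>M i\<in>{1..n}. lborel) (\<lambda>y. ennreal (likelihood n f0 y) * ennreal (lik_ratio n f0 f y))"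
    unfolding data_law_eq_density by (rule density_density_eq) measurable
  also have "\<dots> = data_law n f"
    unfolding data_law_eq_density[of n f] likelihood_eq_lik_ratio[of n f _ f0]
    by (simp add: ennreal_mult' less_imp_le[OF likelihood_pos])
  finally show ?thesis ..
qed

lemma nn_integral_lik_ratio: "(\<integral>\<^sup>+y. ennreal (lik_ratio n f0 f y) \<partial>data_law n f0) = 1"
proof -
  interpret prob_space "data_law n f" by (rule prob_space_data_law)
  have "emeasure (data_law n f) (space (data_law n f0)) = 1"
    using emeasure_space_1 by (simp add: space_data_law)
  thus ?thesis
    by (subst (asm) data_law_change_of_measure[of n f f0])
       (simp add: emeasure_density)
qed

lemma gauss_shift: "gauss a = distr (gauss 0) borel (\<lambda>t. t + a)"
proof -
  have "distributed (gauss 0) lborel (\<lambda>t. t) (\<lambda>t. ennreal (normal_density 0 1 t))"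
    unfolding distributed_def by (auto simp: distr_id2)
  from prob_space.normal_density_affine[OF prob_space_normal_density this, of 1 a]
  have "distr (gauss 0) lborel (\<lambda>t. a + t) = gauss a"
    by (simp add: distributed_def)
  thus ?thesis by (simp add: add.commute cong: distr_cong)
qed

text \<open>For the interchange of integrations over data and step heights it is convenient to keep one
  measure for all \<open>f\<close> and to move the dependence on \<open>f\<close> into the integrand.\<close>

lemma data_law_shift:
  "data_law n f = distr (data_law n (\<lambda>_. 0)) (\<Pi>\<^sub>M i\<in>{1..n}. borel)
     (\<lambda>z. \<lambda>i\<in>{1..n}. z i + f (design n i))"
proof -
  interpret G: product_sigma_finite "\<lambda>i. gauss (f (design n i))"
    by (intro product_sigma_finite.intro prob_space_imp_sigma_finite prob_space_normal_density) auto
  interpret Z: product_sigma_finite "\<lambda>i::nat. gauss 0"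
    by (intro product_sigma_finite.intro prob_space_imp_sigma_finite prob_space_normal_density) auto
  show ?thesis
    unfolding data_law_def[of n f]
  proof (rule G.PiM_eqI[symmetric])
    show "sets (distr (data_law n (\<lambda>_. 0)) (\<Pi>\<^sub>M i\<in>{1..n}. borel) (\<lambda>z. \<lambda>i\<in>{1..n}. z i + f (design n i))) =
      sets (\<Pi>\<^sub>M i\<in>{1..n}. gauss (f (design n i)))"
      unfolding sets_distr by (intro sets_PiM_cong) auto
    fix A assume A: "\<And>i. i \<in> {1..n} \<Longrightarrow> A i \<in> sets (gauss (f (design n i)))"
    have [measurable]: "Pi\<^sub>E {1..n} A \<in> sets (\<Pi>\<^sub>M i\<in>{1..n}. borel)"
      using A by (intro sets_PiM_I_finite) auto
    have "emeasure (distr (data_law n (\<lambda>_. 0)) (\<Pi>\<^sub>M i\<in>{1..n}. borel)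
        (\<lambda>z. \<lambda>i\<in>{1..n}. z i + f (design n i))) (Pi\<^sub>E {1..n} A) =
      emeasure (data_law n (\<lambda>_. 0)) ((\<lambda>z. \<lambda>i\<in>{1..n}. z i + f (design n i)) -` (Pi\<^sub>E {1..n} A) \<inter> space (data_law n (\<lambda>_. 0)))"
      by (rule emeasure_distr) measurable
    also have "(\<lambda>z. \<lambda>i\<in>{1..n}. z i + f (design n i)) -` (Pi\<^sub>E {1..n} A) \<inter> space (data_law n (\<lambda>_. 0))
       = Pi\<^sub>E {1..n} (\<lambda>i. (\<lambda>t. t + f (design n i)) -` A i)"
      by (auto simp: space_data_law PiE_iff)
    also have "emeasure (data_law n (\<lambda>_. 0)) \<dots> = (\<Prod>i\<in>{1..n}. emeasure (gauss 0) ((\<lambda>t. t + f (design n i)) -` A i))"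
      unfolding data_law_def
    proof (rule Z.emeasure_PiM)
      show "(\<lambda>t. t + f (design n i)) -` A i \<in> sets (gauss 0)" if "i \<in> {1..n}" for i
        using measurable_sets_borel[of "\<lambda>t. t + f (design n i)" borel "A i"] A[OF that] by simp
    qed auto
    also have "\<dots> = (\<Prod>i\<in>{1..n}. emeasure (gauss (f (design n i))) (A i))"
      using A by (intro prod.cong refl) (subst gauss_shift[of "f _"], subst emeasure_distr, auto)
    finally show "emeasure (distr (data_law n (\<lambda>_. 0)) (\<Pi>\<^sub>M i\<in>{1..n}. borel)
        (\<lambda>z. \<lambda>i\<in>{1..n}. z i + f (design n i))) (Pi\<^sub>E {1..n} A) =
      (\<Prod>i\<in>{1..n}. emeasure (gauss (f (design n i))) (A i))" .
  qed auto
qed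

section \<open>Cells of interval partitions\<close>

text \<open>The split points together with the end points of the unit interval, so that the cell with
  number \<open>k\<close> lies between the entries \<open>k\<close> and \<open>k + 1\<close>.\<close>

definition breaks :: "real set \<Rightarrow> real list" where
  "breaks U = 0 # sorted_list_of_set U @ [1]"

lemma length_cells [simp]: "length (cells U) = Suc (card U)"
  by (simp add: cells_def Let_def)

lemma cells_nth: "k \<le> card U \<Longrightarrow> cells U ! k = {breaks U ! k <.. breaks U ! Suc k}"
  unfolding cells_def Let_def breaks_def[symmetric]
  by (subst nth_map) (simp_all del: upt_Suc)

lemma length_breaks: "length (breaks U) = card U + 2"
  by (simp add: breaks_def)

lemma breaks_0: "breaks U ! 0 = 0" and breaks_last: "breaks U ! Suc (card U) = 1"
  by (simp_all add: breaks_def nth_append)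

context
  fixes U :: "real set"
  assumes finU: "finite U" and U01: "U \<subseteq> {0<..<1}"
begin

lemma set_breaks: "set (breaks U) = insert 0 (insert 1 U)"
  using finU by (auto simp: breaks_def)

lemma sorted_breaks: "sorted_wrt (<) (breaks U)"
  using finU U01 by (auto simp: breaks_def sorted_wrt_append)

lemma breaks_less: "i < j \<Longrightarrow> j \<le> Suc (card U) \<Longrightarrow> breaks U ! i < breaks U ! j"
  using sorted_wrt_nth_less[OF sorted_breaks, of i j] by (simp add: length_breaks)

lemma breaks_mono: "i \<le> j \<Longrightarrow> j \<le> Suc (card U) \<Longrightarrow> breaks U ! i \<le> breaks U ! j"
  using breaks_less[of i j] by (cases "i = j") auto

lemma breaks_in: "k \<le> Suc (card U) \<Longrightarrow> breaks U ! k \<in> insert 0 (insert 1 U)"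
  using nth_mem[of k "breaks U"] set_breaks by (auto simp: length_breaks)

lemma cells_subset: "k \<le> card U \<Longrightarrow> cells U ! k \<subseteq> {0<..1}"
  using breaks_mono[of 0 k] breaks_mono[of "Suc k" "Suc (card U)"]
  by (auto simp: cells_nth breaks_0 breaks_last)

lemma cells_cover:
  assumes "x \<in> {0<..1}"
  obtains k where "k \<le> card U" "x \<in> cells U ! k"
proof -
  \<comment> \<open>the cell of \<open>x\<close> starts at the last break point strictly to the left of \<open>x\<close>\<close>
  define k where "k = Max {j. j \<le> card U \<and> breaks U ! j < x}"
  have fin: "finite {j. j \<le> card U \<and> breaks U ! j < x}" by simp
  have "0 \<in> {j. j \<le> card U \<and> breaks U ! j < x}" using assms by (simp add: breaks_0)
  hence "k \<in> {j. j \<le> card U \<and> breaks U ! j < x}" unfolding k_def by (intro Max_in[OF fin]) auto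
  moreover have "x \<le> breaks U ! Suc k"
  proof (cases "k = card U")
    case True
    thus ?thesis using assms by (simp add: breaks_last)
  next
    case False
    show ?thesis
    proof (rule ccontr)
      assume "\<not> x \<le> breaks U ! Suc k"
      hence "Suc k \<in> {j. j \<le> card U \<and> breaks U ! j < x}" using False calculation by auto
      from Max_ge[OF fin this] show False by (simp add: k_def)
    qed
  qed
  ultimately have "k \<le> card U" "x \<in> cells U ! k" by (auto simp: cells_nth)
  thus thesis by (rule that)
qed

lemma cells_unique:
  assumes "x \<in> cells U ! j" "x \<in> cells U ! k" "j \<le> card U" "k \<le> card U"
  shows "j = k"
proof (rule ccontr)
  assume "j \<noteq> k"
  then consider "Suc j \<le> k" | "Suc k \<le> j" by linarith
  thus False
  proof cases
    case 1
    with breaks_mono[OF this] assms show False by (simp add: cells_nth)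
  next
    case 2
    with breaks_mono[OF this] assms show False by (simp add: cells_nth)
  qed
qed

lemma step_fun_cells:
  assumes "k \<le> card U" "x \<in> cells U ! k"
  shows "step_fun (cells U) b x = b k"
proof -
  have "step_fun (cells U) b x = (\<Sum>j<Suc (card U). if j = k then b j else 0)"
    unfolding step_fun_def length_cells
  proof (rule sum.cong)
    fix j assume "j \<in> {..<Suc (card U)}"
    hence "j = k" if "x \<in> cells U ! j"
      by (intro cells_unique[OF that assms(2) _ assms(1)]) simp
    thus "b j * indicator (cells U ! j) x = (if j = k then b j else 0)"
      using assms by (cases "j = k") (auto simp: indicator_def)
  qed simp
  also have "\<dots> = b k" using assms by simp
  finally show ?thesis .
qed

text \<open>Two points not separated by a split point lie in the same cell; separation by \<open>u\<close> means
  \<open>x \<le> u < y\<close> because the cells are closed on the right.\<close>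

lemma step_fun_cells_eqI:
  assumes "0 < x" "x \<le> y" "y \<le> 1" "\<forall>u\<in>U. \<not> (x \<le> u \<and> u < y)"
  shows "step_fun (cells U) b x = step_fun (cells U) b y"
proof -
  obtain k where k: "k \<le> card U" "x \<in> cells U ! k" using cells_cover[of x] assms by auto
  have "y \<le> breaks U ! Suc k"
  proof (rule ccontr)
    assume "\<not> y \<le> breaks U ! Suc k"
    moreover from this have "breaks U ! Suc k \<in> U"
      using k assms breaks_in[of "Suc k"] by (auto simp: cells_nth)
    ultimately show False using assms k by (auto simp: cells_nth)
  qed
  hence "y \<in> cells U ! k" using k assms by (simp add: cells_nth)
  thus ?thesis using k by (simp add: step_fun_cells)
qed

lemma no_break_inside_cell:
  assumes k: "k \<le> card U" "x \<in> cells U ! k" "y \<in> cells U ! k" and u: "u \<in> U"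
  shows "\<not> (x \<le> u \<and> u < y)"
proof
  assume xy: "x \<le> u \<and> u < y"
  have "u \<in> set (breaks U)" using set_breaks u by simp
  then obtain j where j: "j < length (breaks U)" "breaks U ! j = u"
    unfolding in_set_conv_nth by blast
  have "\<not> j \<le> k" using breaks_mono[of j k] xy k j by (auto simp: cells_nth)
  hence "breaks U ! Suc k \<le> u" using not_less_eq_eq breaks_mono[of "Suc k" j] j by (auto simp: length_breaks)
  thus False using xy k by (auto simp: cells_nth)
qed

lemma sum_over_cells:
  fixes g :: "nat \<Rightarrow> 'a :: comm_monoid_add"
  shows "(\<Sum>i=1..n. g i) = (\<Sum>k\<le>card U. \<Sum>i | i \<in> {1..n} \<and> design n i \<in> cells U ! k. g i)"
proof -
  have eq: "{1..n} = (\<Union>k\<in>{..card U}. {i \<in> {1..n}. design n i \<in> cells U ! k})"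
  proof (intro equalityI subsetI)
    fix i assume i: "i \<in> {1..n}"
    hence "design n i \<in> {0<..1}" by (auto simp: design_def)
    thus "i \<in> (\<Union>k\<in>{..card U}. {i \<in> {1..n}. design n i \<in> cells U ! k})"
      using i by (elim cells_cover) auto
  qed auto
  have "(\<Sum>i=1..n. g i) = sum g (\<Union>k\<in>{..card U}. {i \<in> {1..n}. design n i \<in> cells U ! k})"
    by (rule arg_cong[OF eq])
  also have "\<dots> = (\<Sum>k\<le>card U. \<Sum>i | i \<in> {1..n} \<and> design n i \<in> cells U ! k. g i)"
  proof (rule sum.UNION_disjoint)
    show "\<forall>j\<in>{..card U}. \<forall>k\<in>{..card U}. j \<noteq> k \<longrightarrow>
      {i \<in> {1..n}. design n i \<in> cells U ! j} \<inter> {i \<in> {1..n}. design n i \<in> cells U ! k} = {}"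
      using cells_unique by blast
  qed simp_all
  finally show ?thesis .
qed

end

lemma split_candidates_subset: "split_candidates n \<subseteq> {0<..<1}"
  by (auto simp: split_candidates_def design_def)

lemma finite_split_candidates: "finite (split_candidates n)"
  by (simp add: split_candidates_def)

lemma finite_subset_split_candidates: "U \<subseteq> split_candidates n \<Longrightarrow> finite U"
  by (rule finite_subset[OF _ finite_split_candidates])

text \<open>Whatever the partition, its cells belong to one family of \<open>(n + 1)\<^sup>2\<close> intervals. This is why a
  union bound over polynomially many intervals can control exponentially many partitions.\<close>

lemma cells_endpoints:
  assumes "U \<subseteq> split_candidates n" "k \<le> card U" "1 \<le> n"
  obtains a b where "a \<le> n" "b \<le> n" "cells U ! k = {design n a<..design n b}"
proof -
  have *: "\<exists>a\<le>n. x = design n a" if "x \<in> insert 0 (insert 1 U)" for x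
  proof -
    have "\<exists>a\<le>n. 0 = design n a" by (intro exI[of _ 0]) (simp add: design_def)
    moreover have "\<exists>a\<le>n. 1 = design n a"
      using assms(3) by (intro exI[of _ n]) (simp add: design_def)
    moreover have "\<exists>a\<le>n. x = design n a" if "x \<in> U"
    proof -
      obtain i where "i \<in> {1..<n}" "x = design n i"
        using \<open>x \<in> U\<close> assms(1) unfolding split_candidates_def by blast
      thus ?thesis by (intro exI[of _ i]) auto
    qed
    ultimately show ?thesis using that by blast
  qed
  have fin: "finite U" using assms(1) by (rule finite_subset_split_candidates)
  have U: "U \<subseteq> {0<..<1}" using assms(1) split_candidates_subset by blast
  obtain a where a: "a \<le> n" "breaks U ! k = design n a"
    using *[OF breaks_in[OF fin U, of k]] assms(2) by auto
  obtain b where b: "b \<le> n" "breaks U ! Suc k = design n b"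
    using *[OF breaks_in[OF fin U, of "Suc k"]] assms(2) by auto
  show thesis using that[OF a(1) b(1)] a b assms(2) by (simp add: cells_nth)
qed

definition points_in :: "nat \<Rightarrow> real set \<Rightarrow> nat set" where
  "points_in n V = {i \<in> {1..n}. design n i \<in> V}"

lemma finite_points_in [simp]: "finite (points_in n V)"
  by (simp add: points_in_def)

lemma cell_mass_eq: "cell_mass n V = real (card (points_in n V)) / real n"
proof -
  have "points_in n V = {1..n} \<inter> {i. design n i \<in> V}" by (auto simp: points_in_def)
  thus ?thesis by (simp add: cell_mass_def indicator_def)
qed

text \<open>The common refinement of two partitions is cut by the union of their split points. It has at
  most as many cells as the two partitions together, and on each of its cells both step functions
  are constant.\<close>

lemma step_fun_constant_on_refinement:
  assumes U: "finite U" "U \<subseteq> {0<..<1}" and U': "finite U'" "U' \<subseteq> {0<..<1}"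
    and k: "k \<le> card (U \<union> U')" "x \<in> cells (U \<union> U') ! k" "y \<in> cells (U \<union> U') ! k"
  shows "step_fun (cells U) b x = step_fun (cells U) b y"
proof -
  have *: "step_fun (cells U) b x = step_fun (cells U) b y"
    if "x \<in> cells (U \<union> U') ! k" "y \<in> cells (U \<union> U') ! k" "x \<le> y" for x y
  proof (rule step_fun_cells_eqI[OF U])
    have fin: "finite (U \<union> U')" and sub: "U \<union> U' \<subseteq> {0<..<1}" using U U' by auto
    have "x \<in> {0<..1}" "y \<in> {0<..1}" using cells_subset[OF fin sub k(1)] that by blast+
    thus "0 < x" "x \<le> y" "y \<le> 1" using that by auto
    show "\<forall>u\<in>U. \<not> (x \<le> u \<and> u < y)"
      using no_break_inside_cell[OF fin sub k(1)] that by blast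
  qed
  show ?thesis
  proof (cases "x \<le> y")
    case True
    thus ?thesis using k by (intro *) auto
  next
    case False
    thus ?thesis using k by (intro *[symmetric]) auto
  qed
qed

section \<open>Regular noise and the expected marginal likelihood\<close>

definition centred_sum :: "nat \<Rightarrow> (real \<Rightarrow> real) \<Rightarrow> real set \<Rightarrow> (nat \<Rightarrow> real) \<Rightarrow> real" where
  "centred_sum n f0 V y = (\<Sum>i\<in>points_in n V. y i - f0 (design n i))"

lemma centred_sum_measurable [measurable]:
  "centred_sum n f0 V \<in> borel_measurable (\<Pi>\<^sub>M i\<in>{1..n}. borel)"
  unfolding centred_sum_def
  by (intro borel_measurable_sum borel_measurable_diff measurable_component_singleton
      borel_measurable_const) (simp add: points_in_def)

lemma sum_indicator_points_in:
  fixes g :: "nat \<Rightarrow> real"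
  shows "(\<Sum>i=1..n. indicator V (design n i) * g i) = (\<Sum>i\<in>points_in n V. g i)"
proof -
  have "(\<Sum>i=1..n. indicator V (design n i) * g i) = (\<Sum>i=1..n. if design n i \<in> V then g i else 0)"
    by (intro sum.cong) (auto simp: indicator_def)
  thus ?thesis unfolding points_in_def by (simp only: sum.inter_filter[OF finite_atLeastAtMost])
qed

text \<open>Perturbing the truth by \<open>c\<close> on an interval turns the likelihood ratio into the normalized
  exponential of the noise sum over this interval. That it integrates to one then replaces the
  computation of a moment generating function.\<close>

lemma lik_ratio_bump:
  "lik_ratio n f0 (\<lambda>x. f0 x + c * indicator V x) y =
     exp (c * centred_sum n f0 V y - c\<^sup>2 * real (card (points_in n V)) / 2)"
proof -
  have "(\<Sum>i=1..n. c * indicator V (design n i) * (y i - f0 (design n i))) = c * centred_sum n f0 V y"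
    unfolding centred_sum_def sum_indicator_points_in[symmetric] sum_distrib_left mult.assoc ..
  moreover have "(\<Sum>i=1..n. (c * indicator V (design n i))\<^sup>2) = c\<^sup>2 * real (card (points_in n V))"
  proof -
    have "(c * indicator V x)\<^sup>2 = c\<^sup>2 * (indicator V x * 1)" for x :: real
      by (simp add: indicator_def)
    thus ?thesis
      using sum_indicator_points_in[of V n "\<lambda>_. 1"] by (simp only: sum_distrib_left[symmetric]) simp
  qed
  ultimately show ?thesis by (simp add: lik_ratio_def)
qed

text \<open>Chernoff's bound: the exponent \<open>c = s * sqrt (T / m)\<close>, for an interval with \<open>m\<close> design points,
  makes the likelihood ratio of the perturbed truth at least \<open>exp (T / 2)\<close> on the event in question,
  and Markov's inequality applies.\<close>

lemma centred_sum_tail_one_sided: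
  assumes "0 \<le> T" and s: "s\<^sup>2 = (1::real)"
  shows "emeasure (data_law n f0)
           {y \<in> space (data_law n f0). sqrt (T * real (card (points_in n V))) < s * centred_sum n f0 V y}
         \<le> ennreal (exp (- T / 2))"
proof (cases "card (points_in n V) = 0")
  case True
  hence "points_in n V = {}" by simp
  thus ?thesis using assms by (simp add: centred_sum_def)
next
  case False
  define m where "m = real (card (points_in n V))"
  have m: "m > 0" using False by (simp add: m_def card_gt_0_iff)
  define c where "c = s * sqrt (T / m)"
  define f where "f = (\<lambda>x. f0 x + c * indicator V x)"
  have c2: "c\<^sup>2 * m = T" using m assms by (simp add: c_def power_mult_distrib)
  let ?M = "data_law n f0"
  have "{y \<in> space ?M. sqrt (T * m) < s * centred_sum n f0 V y} \<subseteq>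
        {y \<in> space ?M. 1 \<le> ennreal (exp (- T / 2)) * ennreal (lik_ratio n f0 f y)}"
  proof safe
    fix y assume y: "sqrt (T * m) < s * centred_sum n f0 V y"
    have "T = sqrt (T / m) * sqrt (T * m)" using m assms by (simp add: real_sqrt_mult real_sqrt_divide)
    also have "\<dots> \<le> sqrt (T / m) * (s * centred_sum n f0 V y)"
      using y m assms by (intro mult_left_mono) auto
    also have "\<dots> = c * centred_sum n f0 V y" by (simp add: c_def)
    finally have "1 \<le> exp (- T / 2) * exp (c * centred_sum n f0 V y - T / 2)"
      by (simp add: exp_add[symmetric])
    also have "exp (c * centred_sum n f0 V y - T / 2) = lik_ratio n f0 f y"
      unfolding f_def lik_ratio_bump m_def[symmetric] c2 ..
    finally show "1 \<le> ennreal (exp (- T / 2)) * ennreal (lik_ratio n f0 f y)"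
      by (simp add: ennreal_mult[symmetric] less_imp_le[OF lik_ratio_pos])
  qed
  hence "emeasure ?M {y \<in> space ?M. sqrt (T * m) < s * centred_sum n f0 V y} \<le>
    emeasure ?M {y \<in> space ?M. 1 \<le> ennreal (exp (- T / 2)) * ennreal (lik_ratio n f0 f y)}"
    by (rule emeasure_mono) measurable
  also have "\<dots> \<le> ennreal (exp (- T / 2)) * (\<integral>\<^sup>+y. ennreal (lik_ratio n f0 f y) * indicator (space ?M) y \<partial>?M)"
  proof -
    have "(\<lambda>y. ennreal (lik_ratio n f0 f y) * indicator (space ?M) y) \<in> borel_measurable ?M"
      by measurable
    from nn_integral_Markov_inequality[OF this, of "ennreal (exp (- T / 2))"]
    show ?thesis by simp
  qed
  also have "(\<integral>\<^sup>+y. ennreal (lik_ratio n f0 f y) * indicator (space ?M) y \<partial>?M) = 1"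
    using nn_integral_lik_ratio[of n f0 f] by (simp cong: nn_integral_cong)
  finally show ?thesis by (simp add: m_def)
qed

text \<open>The event on which the whole analysis takes place: simultaneously for all intervals between
  design points, the noise sum has the order of its standard deviation, up to \<open>sqrt T\<close>. Later
  \<open>T = 6 * ln n\<close>.\<close>

definition regular_noise :: "nat \<Rightarrow> (real \<Rightarrow> real) \<Rightarrow> real \<Rightarrow> (nat \<Rightarrow> real) set" where
  "regular_noise n f0 T = {y \<in> space (data_law n f0). \<forall>a\<in>{..n}. \<forall>b\<in>{..n}.
     \<bar>centred_sum n f0 {design n a<..design n b} y\<bar> \<le>
       sqrt (T * real (card (points_in n {design n a<..design n b})))}"

lemma regular_noise_sets [measurable]: "regular_noise n f0 T \<in> sets (data_law n f0)"
  unfolding regular_noise_def by measurable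

lemma measure_not_regular_noise:
  assumes "0 \<le> T"
  shows "measure (data_law n f0) (space (data_law n f0) - regular_noise n f0 T)
           \<le> 2 * (real n + 1)\<^sup>2 * exp (- T / 2)"
proof -
  let ?M = "data_law n f0"
  interpret prob_space ?M by (rule prob_space_data_law)
  define E where "E s p = {y \<in> space ?M. sqrt (T * real (card (points_in n {design n (fst p)<..design n (snd p)})))
      < s * centred_sum n f0 {design n (fst p)<..design n (snd p)} y}" for s :: real and p
  have E: "E s p \<in> sets ?M" for s p unfolding E_def by measurable
  have "measure ?M (E s p) \<le> exp (- T / 2)" if "s\<^sup>2 = 1" for s p
    using centred_sum_tail_one_sided[OF assms that, of n f0 "{design n (fst p)<..design n (snd p)}"]
    by (simp add: E_def emeasure_eq_measure)
  hence E_le: "measure ?M (E 1 p) \<le> exp (- T / 2)" "measure ?M (E (-1) p) \<le> exp (- T / 2)" for p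
    by simp_all
  have "space ?M - regular_noise n f0 T \<subseteq> (\<Union>p\<in>{..n}\<times>{..n}. E 1 p \<union> E (-1) p)"
    by (force simp: regular_noise_def E_def not_le abs_if split: if_splits)
  hence "measure ?M (space ?M - regular_noise n f0 T) \<le> measure ?M (\<Union>p\<in>{..n}\<times>{..n}. E 1 p \<union> E (-1) p)"
    using E by (intro finite_measure_mono) auto
  also have "\<dots> \<le> (\<Sum>p\<in>{..n}\<times>{..n}. measure ?M (E 1 p \<union> E (-1) p))"
    using E by (intro finite_measure_subadditive_finite) auto
  also have "\<dots> \<le> (\<Sum>p\<in>{..n}\<times>{..n}. 2 * exp (- T / 2))"
  proof (rule sum_mono)
    fix p
    have "measure ?M (E 1 p \<union> E (-1) p) \<le> measure ?M (E 1 p) + measure ?M (E (-1) p)"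
      using E by (intro measure_Un_le)
    thus "measure ?M (E 1 p \<union> E (-1) p) \<le> 2 * exp (- T / 2)"
      using E_le[of p] by linarith
  qed
  also have "\<dots> = 2 * (real n + 1)\<^sup>2 * exp (- T / 2)"
    by (simp add: power2_eq_square algebra_simps)
  finally show ?thesis .
qed

lemma regular_noise_cell:
  assumes "y \<in> regular_noise n f0 T" "U \<subseteq> split_candidates n" "k \<le> card U" "1 \<le> n"
  shows "\<bar>centred_sum n f0 (cells U ! k) y\<bar> \<le> sqrt (T * real (card (points_in n (cells U ! k))))"
proof -
  obtain a b where ab: "a \<le> n" "b \<le> n" "cells U ! k = {design n a<..design n b}"
    using cells_endpoints[OF assms(2-4)] .
  show ?thesis using assms(1) ab(1,2) unfolding ab(3) regular_noise_def by simp
qed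

lemma sets_heights_prior [measurable_cong]: "sets (heights_prior K) = sets (\<Pi>\<^sub>M k\<in>{..<K}. borel)"
  unfolding heights_prior_def by (intro sets_PiM_cong) auto

lemma prob_space_heights_prior: "prob_space (heights_prior K)"
  unfolding heights_prior_def by (intro prob_space_PiM prob_space_normal_density) auto

lemma nn_integral_heights_prior_prod:
  assumes "\<And>k. k < K \<Longrightarrow> g k \<in> borel_measurable borel"
  shows "(\<integral>\<^sup>+b. (\<Prod>k<K. g k (b k)) \<partial>heights_prior K) = (\<Prod>k<K. \<integral>\<^sup>+t. g k t \<partial>gauss 0)"
proof -
  interpret G: product_sigma_finite "\<lambda>i::nat. gauss 0"
    by (intro product_sigma_finite.intro prob_space_imp_sigma_finite prob_space_normal_density) auto
  show ?thesis unfolding heights_prior_def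
    by (rule G.product_nn_integral_prod) (use assms in auto)
qed

lemma step_fun_measurable [measurable]:
  assumes "length P = K"
  shows "(\<lambda>b. step_fun P b x) \<in> borel_measurable (\<Pi>\<^sub>M k\<in>{..<K}. borel)"
  unfolding step_fun_def assms
  by (intro borel_measurable_sum borel_measurable_times measurable_component_singleton) auto

text \<open>Only the boundedness of the normal density by \<open>1 / 2\<close> matters, which reduces the claim to the
  length of the interval.\<close>

lemma std_normal_interval_le:
  assumes "0 < m" "0 \<le> r"
  shows "(\<integral>\<^sup>+t. indicator {t. \<bar>m * t + w\<bar> \<le> r} t \<partial>gauss 0) \<le> ennreal (r / m)"
proof -
  have eq: "{t. \<bar>m * t + w\<bar> \<le> r} = {(- r - w) / m .. (r - w) / m}"
    using assms by (auto simp: abs_le_iff field_simps)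
  have pi: "1 / sqrt (2 * pi) \<le> 1 / 2"
    using pi_gt3 by (intro divide_left_mono real_le_rsqrt) auto
  have dens: "std_normal_density t \<le> 1 / 2" for t
  proof -
    have "std_normal_density t = 1 / sqrt (2 * pi) * exp (- t\<^sup>2 / 2)"
      by (simp add: std_normal_density_def)
    also have "\<dots> \<le> 1 / 2 * 1" using pi by (intro mult_mono) auto
    finally show ?thesis by simp
  qed
  have "(\<integral>\<^sup>+t. indicator {t. \<bar>m * t + w\<bar> \<le> r} t \<partial>gauss 0)
     = (\<integral>\<^sup>+t. ennreal (std_normal_density t) * indicator {(- r - w) / m .. (r - w) / m} t \<partial>lborel)"
    unfolding eq by (subst nn_integral_density) auto
  also have "\<dots> \<le> (\<integral>\<^sup>+t. ennreal (1 / 2) * indicator {(- r - w) / m .. (r - w) / m} t \<partial>lborel)"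
    using dens by (intro nn_integral_mono mult_right_mono ennreal_leI) auto
  also have "\<dots> = ennreal (1 / 2) * ennreal ((r - w) / m - (- r - w) / m)"
    using assms by (subst nn_integral_cmult) (auto simp: divide_right_mono)
  also have "\<dots> = ennreal (r / m)"
    using assms by (subst ennreal_mult[symmetric]) (auto simp: field_simps diff_divide_distrib[symmetric])
  finally show ?thesis .
qed

lemma lik_ratio_joint_measurable:
  assumes "length P = K"
  shows "(\<lambda>(b, y). lik_ratio n f0 (step_fun P b) y) \<in>
    borel_measurable ((\<Pi>\<^sub>M k\<in>{..<K}. borel) \<Otimes>\<^sub>M (\<Pi>\<^sub>M i\<in>{1..n}. borel))"
  unfolding lik_ratio_def split_beta step_fun_def assms by measurable

lemma prod_indicator:
  "finite I \<Longrightarrow>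
    (\<Prod>k\<in>I. indicator (A k) (b k)) = (if \<forall>k\<in>I. b k \<in> A k then 1 else 0 :: 'a :: comm_semiring_1)"
  by (induction I rule: finite_induct) auto

text \<open>The key estimate against overfitting: on the regular event, every cell of a candidate partition
  costs the factor \<open>sqrt (T / m)\<close> in expected marginal likelihood, \<open>m\<close> being its number of design
  points, and this holds whatever the truth is.

  Integrating the likelihood ratio against the law at the truth gives the law at the candidate. There
  the regular event, formulated with the noise of the truth, forces the height of each cell into an
  interval whose half-length is \<open>sqrt (T / m)\<close>; its position depends on the noise and on the truth,
  but the prior probability of such an interval is bounded by its half-length in any position.
  Without the restriction to the regular event the expectation would be one.\<close>

lemma expected_marginal_on_regular_noise:
  assumes U: "U \<subseteq> split_candidates n" and n: "1 \<le> n" and T: "0 \<le> T"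
    and pos: "\<And>k. k \<le> card U \<Longrightarrow> points_in n (cells U ! k) \<noteq> {}"
  shows "(\<integral>\<^sup>+y. indicator (regular_noise n f0 T) y *
            (\<integral>\<^sup>+b. ennreal (lik_ratio n f0 (step_fun (cells U) b) y) \<partial>heights_prior (Suc (card U)))
          \<partial>data_law n f0)
         \<le> (\<Prod>k\<le>card U. ennreal (sqrt (T / real (card (points_in n (cells U ! k))))))"
proof -
  have finU: "finite U" using U by (rule finite_subset_split_candidates)
  have U01: "U \<subseteq> {0<..<1}" using U split_candidates_subset by blast
  let ?K = "Suc (card U)"
  let ?M = "data_law n f0" and ?Z = "data_law n (\<lambda>_. 0)" and ?H = "heights_prior ?K"
  define m where "m k = real (card (points_in n (cells U ! k)))" for k
  have m: "m k > 0" if "k \<le> card U" for k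
    using pos[OF that] by (simp add: m_def card_gt_0_iff)
  let ?S = "\<lambda>k. centred_sum n f0 (cells U ! k)"
  define Box where "Box = {y \<in> space (\<Pi>\<^sub>M i\<in>{1..n}. (borel::real measure)). \<forall>k\<in>{..card U}. \<bar>?S k y\<bar> \<le> sqrt (T * m k)}"
  have Box_sets [measurable]: "Box \<in> sets (\<Pi>\<^sub>M i\<in>{1..n}. borel)" unfolding Box_def by measurable
  have [measurable]: "(\<lambda>(b, y). lik_ratio n f0 (step_fun (cells U) b) y) \<in>
    borel_measurable ((\<Pi>\<^sub>M k\<in>{..<?K}. borel) \<Otimes>\<^sub>M (\<Pi>\<^sub>M i\<in>{1..n}. borel))"
    by (rule lik_ratio_joint_measurable) simp
  interpret M: prob_space ?M by (rule prob_space_data_law)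
  interpret Z: prob_space ?Z by (rule prob_space_data_law)
  interpret H: prob_space ?H by (rule prob_space_heights_prior)
  interpret HM: pair_sigma_finite ?H ?M ..
  interpret HZ: pair_sigma_finite ?H ?Z ..

  have shift_S: "?S k (\<lambda>i\<in>{1..n}. z i + step_fun (cells U) b (design n i)) = m k * b k + ?S k z"
    if "k \<le> card U" for k b z
  proof -
    have "?S k (\<lambda>i\<in>{1..n}. z i + step_fun (cells U) b (design n i)) =
      (\<Sum>i\<in>points_in n (cells U ! k). b k + (z i - f0 (design n i)))"
      unfolding centred_sum_def
      using step_fun_cells[OF finU U01 that] by (intro sum.cong) (auto simp: points_in_def)
    thus ?thesis by (simp add: sum.distrib m_def centred_sum_def)
  qed

  have "(\<integral>\<^sup>+y. indicator (regular_noise n f0 T) y * (\<integral>\<^sup>+b. ennreal (lik_ratio n f0 (step_fun (cells U) b) y) \<partial>?H) \<partial>?M)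
    \<le> (\<integral>\<^sup>+y. indicator Box y * (\<integral>\<^sup>+b. ennreal (lik_ratio n f0 (step_fun (cells U) b) y) \<partial>?H) \<partial>?M)"
  proof (intro nn_integral_mono mult_right_mono)
    fix y
    have "y \<in> regular_noise n f0 T \<Longrightarrow> y \<in> Box"
      using regular_noise_cell[OF _ U _ n, of y f0 T]
      by (auto simp: Box_def m_def regular_noise_def space_data_law space_PiM)
    thus "(indicator (regular_noise n f0 T) y :: ennreal) \<le> indicator Box y"
      by (auto simp: indicator_def)
  qed simp
  also have "\<dots> = (\<integral>\<^sup>+y. (\<integral>\<^sup>+b. indicator Box y * ennreal (lik_ratio n f0 (step_fun (cells U) b) y) \<partial>?H) \<partial>?M)"
    by (intro nn_integral_cong nn_integral_cmult[symmetric])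
       (measurable, auto simp: space_data_law space_PiM)
  also have "\<dots> = (\<integral>\<^sup>+b. (\<integral>\<^sup>+y. indicator Box y * ennreal (lik_ratio n f0 (step_fun (cells U) b) y) \<partial>?M) \<partial>?H)"
    by (rule HM.Fubini') measurable
  also have "\<dots> = (\<integral>\<^sup>+b. emeasure (data_law n (step_fun (cells U) b)) Box \<partial>?H)"
  proof (rule nn_integral_cong)
    fix b
    show "(\<integral>\<^sup>+y. indicator Box y * ennreal (lik_ratio n f0 (step_fun (cells U) b) y) \<partial>?M) =
      emeasure (data_law n (step_fun (cells U) b)) Box"
      unfolding data_law_change_of_measure[of n "step_fun (cells U) b" f0]
      by (subst emeasure_density) (simp_all add: mult.commute)
  qed
  also have "\<dots> = (\<integral>\<^sup>+b. (\<integral>\<^sup>+z. (\<Prod>k<?K. indicator {t. \<bar>m k * t + ?S k z\<bar> \<le> sqrt (T * m k)} (b k)) \<partial>?Z) \<partial>?H)"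
  proof (rule nn_integral_cong)
    fix b
    let ?sh = "\<lambda>z. \<lambda>i\<in>{1..n}. z i + step_fun (cells U) b (design n i)"
    have "emeasure (data_law n (step_fun (cells U) b)) Box = (\<integral>\<^sup>+y. indicator Box y \<partial>distr ?Z (\<Pi>\<^sub>M i\<in>{1..n}. borel) ?sh)"
      unfolding data_law_shift[of n "step_fun (cells U) b"]
      by (rule nn_integral_indicator[symmetric]) (simp only: sets_distr Box_sets)
    also have "\<dots> = (\<integral>\<^sup>+z. indicator Box (?sh z) \<partial>?Z)"
      by (rule nn_integral_distr) measurable
    also have "\<dots> = (\<integral>\<^sup>+z. (\<Prod>k<?K. indicator {t. \<bar>m k * t + ?S k z\<bar> \<le> sqrt (T * m k)} (b k)) \<partial>?Z)"
    proof (rule nn_integral_cong)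
      fix z
      have "(\<forall>k\<in>{..<?K}. b k \<in> {t. \<bar>m k * t + ?S k z\<bar> \<le> sqrt (T * m k)}) \<longleftrightarrow> ?sh z \<in> Box"
        using shift_S[of _ z b] by (auto simp: Box_def space_PiM less_Suc_eq_le)
      thus "indicator Box (?sh z) = (\<Prod>k<?K. indicator {t. \<bar>m k * t + ?S k z\<bar> \<le> sqrt (T * m k)} (b k) :: ennreal)"
        unfolding prod_indicator[OF finite_lessThan] by (simp only: indicator_def of_bool_def)
    qed
    finally show "emeasure (data_law n (step_fun (cells U) b)) Box = \<dots>" .
  qed
  also have "\<dots> = (\<integral>\<^sup>+z. (\<integral>\<^sup>+b. (\<Prod>k<?K. indicator {t. \<bar>m k * t + ?S k z\<bar> \<le> sqrt (T * m k)} (b k)) \<partial>?H) \<partial>?Z)"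
  proof (rule HZ.Fubini'[symmetric])
    have "(\<lambda>p. indicator {t. \<bar>m k * t + ?S k (snd p)\<bar> \<le> sqrt (T * m k)} (fst p k) :: ennreal) \<in>
      borel_measurable (?H \<Otimes>\<^sub>M ?Z)" if "k < ?K" for k
    proof -
      have [measurable]: "(\<lambda>p. fst p k) \<in> borel_measurable (?H \<Otimes>\<^sub>M ?Z)"
      proof (rule measurable_compose[OF measurable_fst])
        show "(\<lambda>b. b k) \<in> borel_measurable ?H"
          using that unfolding measurable_cong_sets[OF sets_heights_prior refl]
          by (intro measurable_component_singleton) simp
      qed
      have "(\<lambda>p. indicator {t. \<bar>m k * t + ?S k (snd p)\<bar> \<le> sqrt (T * m k)} (fst p k) :: ennreal) =
        (\<lambda>p. if \<bar>m k * fst p k + ?S k (snd p)\<bar> \<le> sqrt (T * m k) then 1 else 0)"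
        by (auto simp: indicator_def)
      thus ?thesis by simp
    qed
    thus "(\<lambda>(b, z). \<Prod>k<?K. indicator {t. \<bar>m k * t + ?S k z\<bar> \<le> sqrt (T * m k)} (b k) :: ennreal)
      \<in> borel_measurable (?H \<Otimes>\<^sub>M ?Z)"
      unfolding split_beta by (intro borel_measurable_prod_ennreal) auto
  qed
  also have "\<dots> \<le> (\<integral>\<^sup>+z. (\<Prod>k<?K. ennreal (sqrt (T / m k))) \<partial>?Z)"
  proof (rule nn_integral_mono)
    fix z
    have "(\<integral>\<^sup>+b. (\<Prod>k<?K. indicator {t. \<bar>m k * t + ?S k z\<bar> \<le> sqrt (T * m k)} (b k)) \<partial>?H) =
      (\<Prod>k<?K. \<integral>\<^sup>+t. indicator {t. \<bar>m k * t + ?S k z\<bar> \<le> sqrt (T * m k)} t \<partial>gauss 0)"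
      by (rule nn_integral_heights_prior_prod) measurable
    also have "\<dots> \<le> (\<Prod>k<?K. ennreal (sqrt (T * m k) / m k))"
      using m T by (intro prod_mono_ennreal std_normal_interval_le) (auto simp: less_Suc_eq_le less_imp_le)
    also have "\<dots> = (\<Prod>k<?K. ennreal (sqrt (T / m k)))"
    proof (intro prod.cong arg_cong[where f = ennreal] refl)
      fix k assume "k \<in> {..<?K}"
      hence "m k > 0" using m by auto
      thus "sqrt (T * m k) / m k = sqrt (T / m k)"
        by (simp add: real_sqrt_mult real_sqrt_divide field_simps)
    qed
    finally show "(\<integral>\<^sup>+b. (\<Prod>k<?K. indicator {t. \<bar>m k * t + ?S k z\<bar> \<le> sqrt (T * m k)} (b k)) \<partial>?H) \<le> \<dots>" .
  qed
  also have "\<dots> = (\<Prod>k\<le>card U. ennreal (sqrt (T / m k)))"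
    by (simp add: lessThan_Suc_atMost Z.emeasure_space_1)
  finally show ?thesis unfolding m_def .
qed

section \<open>The prior as a finite mixture\<close>

lemma BI_K_cells:
  assumes "P \<in> BI_K n Cmin Cmax K"
  obtains U where "U \<subseteq> split_candidates n" "K = Suc (card U)" "P = cells U"
    "balanced n Cmin Cmax (cells U)"
  using assms by (auto simp: BI_K_def)

lemma length_BI_K: "P \<in> BI_K n Cmin Cmax K \<Longrightarrow> length P = K"
  by (erule BI_K_cells) simp

lemma finite_BI_K: "finite (BI_K n Cmin Cmax K)"
proof (rule finite_subset)
  show "BI_K n Cmin Cmax K \<subseteq> cells ` Pow (split_candidates n)" by (auto simp: BI_K_def)
qed (simp add: finite_split_candidates)

lemma card_split_candidates_le: "card (split_candidates n) \<le> n - 1"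
  using card_image_le[of "{1..<n}" "design n"] by (simp add: split_candidates_def)

lemma card_BI_K_le:
  assumes "1 \<le> n"
  shows "card (BI_K n Cmin Cmax K) \<le> n ^ K"
proof -
  let ?A = "{U. U \<subseteq> split_candidates n \<and> card U = K - 1}"
  have "BI_K n Cmin Cmax K \<subseteq> cells ` ?A" by (auto simp: BI_K_def)
  hence "card (BI_K n Cmin Cmax K) \<le> card (cells ` ?A)"
    by (rule card_mono[rotated]) (simp add: finite_split_candidates)
  also have "\<dots> \<le> card ?A" by (rule card_image_le) (simp add: finite_split_candidates)
  also have "\<dots> = card (split_candidates n) choose (K - 1)"
    by (rule n_subsets) (rule finite_split_candidates)
  also have "\<dots> \<le> (card (split_candidates n) choose (K - 1)) * fact (K - 1)"
    by (simp add: Suc_le_eq)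
  also have "\<dots> \<le> card (split_candidates n) ^ (K - 1)" by (rule binomial_fact_pow)
  also have "\<dots> \<le> n ^ (K - 1)" using card_split_candidates_le[of n] by (intro power_mono) auto
  also have "\<dots> \<le> n ^ K" using assms by (intro power_increasing) auto
  finally show ?thesis .
qed

lemma admissible_K_le:
  assumes "1 \<le> n" "K \<in> admissible_K n Cmin Cmax"
  shows "K \<le> n"
proof -
  obtain U where "U \<subseteq> split_candidates n" "K = Suc (card U)"
    using assms(2) by (auto simp: admissible_K_def BI_K_def)
  moreover from this have "card U \<le> card (split_candidates n)"
    by (intro card_mono finite_split_candidates)
  ultimately show ?thesis using card_split_candidates_le[of n] assms(1) by linarith
qed

lemma finite_admissible_K:
  assumes "1 \<le> n"
  shows "finite (admissible_K n Cmin Cmax)"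
proof (rule finite_subset)
  show "admissible_K n Cmin Cmax \<subseteq> {..n}" using admissible_K_le[OF assms] by blast
qed simp

lemma trivial_partition_balanced:
  assumes "1 \<le> n" "0 < Cmin" "Cmin \<le> 1" "1 \<le> Cmax"
  shows "cells {} \<in> BI_K n Cmin Cmax 1"
proof -
  have "design n i \<in> {0<..1}" if "i \<in> {1..n}" for i using that by (auto simp: design_def)
  hence "points_in n {0<..1} = {1..n}" by (auto simp: points_in_def)
  hence "cell_mass n {0<..1} = 1" using assms by (simp add: cell_mass_eq)
  moreover have "cells {} = [{0<..1}]" by (simp add: cells_def)
  moreover have "Cmin\<^sup>2 \<le> 1" "1 \<le> Cmax\<^sup>2" using assms by (simp_all add: power_le_one)
  ultimately have "balanced n Cmin Cmax (cells {})" by (simp add: balanced_def)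
  thus ?thesis unfolding BI_K_def by fastforce
qed

lemma points_in_balanced:
  assumes "balanced n Cmin Cmax (cells U)" "k \<le> card U" "1 \<le> n"
  shows "Cmin\<^sup>2 * real n / real (Suc (card U)) \<le> real (card (points_in n (cells U ! k)))"
proof -
  have "cells U ! k \<in> set (cells U)" using assms(2) by (intro nth_mem) simp
  with assms(1) have "Cmin\<^sup>2 / real (Suc (card U)) \<le> cell_mass n (cells U ! k)"
    unfolding balanced_def by fastforce
  thus ?thesis using assms(3) by (simp add: cell_mass_eq field_simps)
qed

lemma space_step_space: "space (step_space n Cmin Cmax) = step_class n Cmin Cmax"
  by (simp add: step_space_def space_restrict_space space_PiM)

lemma eval_measurable: "(\<lambda>f. f x) \<in> borel_measurable (step_space n Cmin Cmax)"
  unfolding step_space_def by (intro measurable_restrict_space1 measurable_component_singleton) simp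

lemma step_fun_measurable_step_space:
  assumes "P \<in> BI_K n Cmin Cmax K" "1 \<le> K"
  shows "step_fun P \<in> heights_prior K \<rightarrow>\<^sub>M step_space n Cmin Cmax"
  unfolding step_space_def
proof (rule measurable_restrict_space2)
  show "step_fun P \<in> space (heights_prior K) \<rightarrow> step_class n Cmin Cmax"
    using assms by (auto simp: step_class_def BI_def)
  show "step_fun P \<in> heights_prior K \<rightarrow>\<^sub>M Pi\<^sub>M UNIV (\<lambda>x. borel)"
  proof (rule measurable_PiM_single')
    fix x :: real
    have "length P = K" using assms(1) by (rule length_BI_K)
    from step_fun_measurable[OF this]
    show "(\<lambda>b. step_fun P b x) \<in> borel_measurable (heights_prior K)" by measurable
  qed auto
qed

definition K_prob :: "nat \<Rightarrow> real \<Rightarrow> real \<Rightarrow> real \<Rightarrow> nat \<Rightarrow> real" where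
  "K_prob n Cmin Cmax cK k = K_weight cK k / (\<Sum>j\<in>admissible_K n Cmin Cmax. K_weight cK j)"

text \<open>The conditional prior expectation of \<open>g\<close> given the number of cells, as an extended nonnegative
  number so that no integrability has to be discussed.\<close>

definition partition_average :: "nat \<Rightarrow> real \<Rightarrow> real \<Rightarrow> nat \<Rightarrow> ((real \<Rightarrow> real) \<Rightarrow> ennreal) \<Rightarrow> ennreal" where
  "partition_average n Cmin Cmax K g =
     (\<Sum>P\<in>BI_K n Cmin Cmax K. ennreal (1 / real (card (BI_K n Cmin Cmax K))) *
        (\<integral>\<^sup>+b. g (step_fun P b) \<partial>heights_prior K))"

locale balanced_prior =
  fixes n :: nat and Cmin Cmax cK :: real
  assumes n: "1 \<le> n" and Cmin: "0 < Cmin" "Cmin \<le> 1" and Cmax: "1 \<le> Cmax" and cK: "0 < cK"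
begin

abbreviation "adm \<equiv> admissible_K n Cmin Cmax"
abbreviation "parts \<equiv> BI_K n Cmin Cmax"
abbreviation "K_pr \<equiv> K_prob n Cmin Cmax cK"
abbreviation "avg \<equiv> partition_average n Cmin Cmax"
abbreviation "pri \<equiv> prior n Cmin Cmax cK"
abbreviation "post \<equiv> posterior n Cmin Cmax cK"

lemma one_admissible: "1 \<in> adm"
  using trivial_partition_balanced[OF n Cmin Cmax] by (auto simp: admissible_K_def)

lemma finite_adm: "finite adm"
  using n by (rule finite_admissible_K)

lemma K_weight_le_1: "1 \<le> k \<Longrightarrow> K_weight cK k \<le> 1"
  using cK by (simp add: K_weight_def)

lemma normalizer_bounds:
  "1 \<le> (\<Sum>j\<in>adm. K_weight cK j)" "(\<Sum>j\<in>adm. K_weight cK j) \<le> real n"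
proof -
  have "K_weight cK 1 \<le> (\<Sum>j\<in>adm. K_weight cK j)"
    by (rule member_le_sum[OF one_admissible _ finite_adm]) (simp add: K_weight_def)
  thus "1 \<le> (\<Sum>j\<in>adm. K_weight cK j)" by (simp add: K_weight_def)
  have "(\<Sum>j\<in>adm. K_weight cK j) \<le> (\<Sum>j\<in>adm. 1)"
    by (intro sum_mono K_weight_le_1) (auto simp: admissible_K_def)
  also have "\<dots> = real (card adm)" by simp
  also have "card adm \<le> card {1..n}"
  proof (rule card_mono)
    show "adm \<subseteq> {1..n}"
      using admissible_K_le[OF n, of _ Cmin Cmax] unfolding admissible_K_def by fastforce
  qed simp
  finally show "(\<Sum>j\<in>adm. K_weight cK j) \<le> real n" by simp
qed

lemma K_prob_nonneg: "0 \<le> K_pr k"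
  using normalizer_bounds(1) by (simp add: K_prob_def K_weight_def)

lemma K_prob_le_weight: "K_pr k \<le> K_weight cK k"
proof -
  have "K_weight cK k / (\<Sum>j\<in>adm. K_weight cK j) \<le> K_weight cK k / 1"
    using normalizer_bounds(1) by (intro divide_left_mono) (auto simp: K_weight_def)
  thus ?thesis by (simp add: K_prob_def)
qed

lemma K_prob_ge_weight: "K_weight cK k / real n \<le> K_pr k"
  unfolding K_prob_def using normalizer_bounds n
  by (intro divide_left_mono) (auto simp: K_weight_def)

lemma sum_K_prob: "(\<Sum>k\<in>adm. K_pr k) = 1"
  using normalizer_bounds(1) by (simp add: K_prob_def sum_divide_distrib[symmetric])

lemma admD: "K \<in> adm \<Longrightarrow> 1 \<le> K" "K \<in> adm \<Longrightarrow> parts K \<noteq> {}"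
  by (auto simp: admissible_K_def)

lemma heights_kernel:
  assumes "K \<in> adm"
  shows "(\<lambda>P. distr (heights_prior K) (step_space n Cmin Cmax) (step_fun P)) \<in>
    uniform_count_measure (parts K) \<rightarrow>\<^sub>M subprob_algebra (step_space n Cmin Cmax)"
proof -
  have "distr (heights_prior K) (step_space n Cmin Cmax) (step_fun P) \<in> space (subprob_algebra (step_space n Cmin Cmax))"
    if "P \<in> parts K" for P
    using step_fun_measurable_step_space[OF that admD(1)[OF assms]] prob_space_heights_prior
    by (auto simp: space_subprob_algebra intro!: prob_space_imp_subprob_space prob_space.prob_space_distr)
  thus ?thesis by (auto simp: measurable_def space_uniform_count_measure sets_uniform_count_measure)
qed

lemma partition_kernel:
  "(\<lambda>K. uniform_count_measure (parts K) \<bind>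
      (\<lambda>P. distr (heights_prior K) (step_space n Cmin Cmax) (step_fun P))) \<in>
    K_prior n Cmin Cmax cK \<rightarrow>\<^sub>M subprob_algebra (step_space n Cmin Cmax)"
proof -
  have "uniform_count_measure (parts K) \<bind>
      (\<lambda>P. distr (heights_prior K) (step_space n Cmin Cmax) (step_fun P)) \<in>
      space (subprob_algebra (step_space n Cmin Cmax))" if K: "K \<in> adm" for K
  proof -
    have "subprob_space (uniform_count_measure (parts K))"
      using admD(2)[OF K]
      by (intro prob_space_imp_subprob_space prob_space_uniform_count_measure finite_BI_K)
    from subprob_space_bind[OF this heights_kernel[OF K]] sets_bind_measurable[OF heights_kernel[OF K]]
    show ?thesis using admD(2)[OF K]
      by (simp add: space_subprob_algebra space_uniform_count_measure)
  qed
  thus ?thesis by (auto simp: measurable_def K_prior_def space_point_measure sets_point_measure)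
qed

lemma sets_prior: "sets pri = sets (step_space n Cmin Cmax)"
  unfolding prior_def using one_admissible
  by (intro sets_bind_measurable[OF partition_kernel]) (auto simp: K_prior_def space_point_measure)

lemma nn_integral_prior:
  assumes g: "g \<in> borel_measurable (step_space n Cmin Cmax)"
  shows "(\<integral>\<^sup>+f. g f \<partial>pri) = (\<Sum>K\<in>adm. ennreal (K_pr K) * avg K g)"
proof -
  have inner: "(\<integral>\<^sup>+f. g f \<partial>(uniform_count_measure (parts K) \<bind>
      (\<lambda>P. distr (heights_prior K) (step_space n Cmin Cmax) (step_fun P)))) = avg K g"
    if K: "K \<in> adm" for K
  proof -
    have "(\<integral>\<^sup>+f. g f \<partial>(uniform_count_measure (parts K) \<bind>
      (\<lambda>P. distr (heights_prior K) (step_space n Cmin Cmax) (step_fun P)))) =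
      (\<integral>\<^sup>+P. \<integral>\<^sup>+f. g f \<partial>distr (heights_prior K) (step_space n Cmin Cmax) (step_fun P)
        \<partial>uniform_count_measure (parts K))"
      by (rule nn_integral_bind[OF g heights_kernel[OF K]])
    also have "\<dots> = (\<Sum>P\<in>parts K. ennreal (1 / real (card (parts K))) *
      (\<integral>\<^sup>+f. g f \<partial>distr (heights_prior K) (step_space n Cmin Cmax) (step_fun P)))"
      unfolding uniform_count_measure_def
      by (subst nn_integral_point_measure_finite) (auto simp: finite_BI_K)
    also have "\<dots> = avg K g"
      unfolding partition_average_def
    proof (intro sum.cong refl arg_cong2[where f = "(*)"])
      fix P assume "P \<in> parts K"
      from step_fun_measurable_step_space[OF this admD(1)[OF K]]
      show "(\<integral>\<^sup>+f. g f \<partial>distr (heights_prior K) (step_space n Cmin Cmax) (step_fun P)) =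
        (\<integral>\<^sup>+b. g (step_fun P b) \<partial>heights_prior K)"
        using g by (intro nn_integral_distr) simp_all
    qed
    finally show ?thesis .
  qed
  have "(\<integral>\<^sup>+f. g f \<partial>pri) = (\<integral>\<^sup>+K. \<integral>\<^sup>+f. g f \<partial>(uniform_count_measure (parts K) \<bind>
      (\<lambda>P. distr (heights_prior K) (step_space n Cmin Cmax) (step_fun P))) \<partial>K_prior n Cmin Cmax cK)"
    unfolding prior_def by (rule nn_integral_bind[OF g partition_kernel])
  also have "\<dots> = (\<Sum>K\<in>adm. ennreal (K_pr K) * avg K g)"
    unfolding K_prior_def K_prob_def[symmetric]
    by (subst nn_integral_point_measure_finite[OF finite_adm]) (simp add: inner cong: sum.cong)
  finally show ?thesis .
qed

lemma likelihood_measurable_step_space [measurable]: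
  "(\<lambda>f. likelihood n f y) \<in> borel_measurable (step_space n Cmin Cmax)"
proof -
  note eval_measurable [measurable]
  show ?thesis unfolding likelihood_def normal_density_def by measurable
qed

lemma lik_ratio_measurable_step_space [measurable]:
  "(\<lambda>f. lik_ratio n f0 f y) \<in> borel_measurable (step_space n Cmin Cmax)"
proof -
  note eval_measurable [measurable]
  show ?thesis unfolding lik_ratio_def by measurable
qed

text \<open>Dividing numerator and denominator of Bayes' formula by the likelihood at the truth replaces
  likelihoods by likelihood ratios; the bound on the evidence from below excludes that the
  denominator vanishes.\<close>

lemma posterior_measure_le:
  assumes B: "B \<in> sets (step_space n Cmin Cmax)" and d: "0 < d" and v: "0 \<le> v"
    and den: "ennreal d \<le> (\<integral>\<^sup>+f. ennreal (lik_ratio n f0 f y) \<partial>pri)"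
    and num: "(\<integral>\<^sup>+f. ennreal (lik_ratio n f0 f y) * indicator B f \<partial>pri) \<le> ennreal v"
  shows "measure (post y) B \<le> v / d"
proof -
  note [measurable_cong] = sets_prior
  have [measurable]: "B \<in> sets (step_space n Cmin Cmax)" by fact
  let ?L = "ennreal (likelihood n f0 y)"
  let ?D = "\<integral>\<^sup>+f. ennreal (lik_ratio n f0 f y) \<partial>pri"
  let ?N = "\<integral>\<^sup>+f. ennreal (lik_ratio n f0 f y) * indicator B f \<partial>pri"
  have split: "ennreal (likelihood n f y) = ?L * ennreal (lik_ratio n f0 f y)" for f
    unfolding likelihood_eq_lik_ratio[of n f y f0]
    by (intro ennreal_mult less_imp_le likelihood_pos lik_ratio_pos)
  have D: "(\<integral>\<^sup>+f. ennreal (likelihood n f y) \<partial>pri) = ?L * ?D"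
    by (subst nn_integral_cmult[symmetric]) (measurable, rule nn_integral_cong, rule split)
  have "emeasure (post y) B = (\<integral>\<^sup>+f. ennreal (likelihood n f y) / (?L * ?D) * indicator B f \<partial>pri)"
    unfolding posterior_def D by (rule emeasure_density) measurable
  also have "\<dots> = (\<integral>\<^sup>+f. ?L * (ennreal (lik_ratio n f0 f y) * indicator B f) / (?L * ?D) \<partial>pri)"
    by (intro nn_integral_cong, subst split) (simp only: divide_ennreal_def mult_ac)
  also have "\<dots> = (\<integral>\<^sup>+f. ?L * (ennreal (lik_ratio n f0 f y) * indicator B f) \<partial>pri) / (?L * ?D)"
    by (rule nn_integral_divide) measurable
  also have "\<dots> = ?L * ?N / (?L * ?D)"
  proof -
    have "(\<lambda>f. ennreal (lik_ratio n f0 f y) * indicator B f) \<in> borel_measurable pri" by measurable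
    from nn_integral_cmult[OF this] show ?thesis by simp
  qed
  also have "\<dots> \<le> ennreal (v / d)"
  proof (rule divide_le_posI_ennreal)
    have "0 < ?D" using den d by (meson ennreal_less_zero_iff less_le_trans)
    thus "0 < ?L * ?D" using likelihood_pos[of n f0 y] by (simp add: ennreal_zero_less_mult_iff)
    have "?N \<le> ennreal (v / d) * ennreal d" using num d v by (simp add: ennreal_mult[symmetric])
    also have "\<dots> \<le> ennreal (v / d) * ?D" by (intro mult_left_mono den) simp
    finally have "?L * ?N \<le> ?L * (ennreal (v / d) * ?D)" by (rule mult_left_mono) simp
    thus "?L * ?N \<le> ?L * ?D * ennreal (v / d)" by (simp add: mult_ac)
  qed
  finally show ?thesis
    unfolding measure_def using d v by (intro enn2real_leI) auto
qed

end

section \<open>Likelihood ratio bounds on the regular event\<close>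

lemma sum_constant_on_cells:
  fixes g :: "real \<Rightarrow> real"
  assumes "finite U" "U \<subseteq> {0<..<1}"
    and "\<And>k i. k \<le> card U \<Longrightarrow> i \<in> points_in n (cells U ! k) \<Longrightarrow> g (design n i) = d k"
  shows "(\<Sum>i=1..n. g (design n i) * h i) = (\<Sum>k\<le>card U. d k * (\<Sum>i\<in>points_in n (cells U ! k). h i))"
  unfolding sum_over_cells[OF assms(1,2)] points_in_def[symmetric] sum_distrib_left
  by (intro sum.cong) (use assms(3) in auto)

text \<open>Bounds on the likelihood ratio and on the empirical distance thereby reduce to one quadratic
  polynomial in the height difference for each cell.\<close>

lemma lik_ratio_constant_on_cells:
  assumes U: "finite U" "U \<subseteq> {0<..<1}"
    and d: "\<And>k i. k \<le> card U \<Longrightarrow> i \<in> points_in n (cells U ! k) \<Longrightarrow>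
              f (design n i) - f0 (design n i) = d k"
  shows "lik_ratio n f0 f y = exp (\<Sum>k\<le>card U. d k * centred_sum n f0 (cells U ! k) y
            - (d k)\<^sup>2 * real (card (points_in n (cells U ! k))) / 2)"
    and "(\<Sum>i=1..n. (f (design n i) - f0 (design n i))\<^sup>2) =
         (\<Sum>k\<le>card U. (d k)\<^sup>2 * real (card (points_in n (cells U ! k))))"
proof -
  show sq: "(\<Sum>i=1..n. (f (design n i) - f0 (design n i))\<^sup>2) =
         (\<Sum>k\<le>card U. (d k)\<^sup>2 * real (card (points_in n (cells U ! k))))"
    using sum_constant_on_cells[OF U, of n "\<lambda>x. (f x - f0 x)\<^sup>2" "\<lambda>k. (d k)\<^sup>2" "\<lambda>_. 1"] d by simp
  have "(\<Sum>i=1..n. (f (design n i) - f0 (design n i)) * (y i - f0 (design n i))) =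
      (\<Sum>k\<le>card U. d k * centred_sum n f0 (cells U ! k) y)"
    unfolding centred_sum_def
    by (rule sum_constant_on_cells[OF U, of n "\<lambda>x. f x - f0 x" d]) (rule d)
  thus "lik_ratio n f0 f y = exp (\<Sum>k\<le>card U. d k * centred_sum n f0 (cells U ! k) y
            - (d k)\<^sup>2 * real (card (points_in n (cells U ! k))) / 2)"
    unfolding lik_ratio_def sq by (simp add: sum_subtractf sum_divide_distrib)
qed

lemma emp_norm_sq:
  assumes "1 \<le> n"
  shows "real n * (emp_norm n g)\<^sup>2 = (\<Sum>i=1..n. (g (design n i))\<^sup>2)"
  using assms by (simp add: emp_norm_def sum_nonneg)

text \<open>Far from the truth the likelihood ratio is small, uniformly over all functions with a given
  number of cells. On each cell of the common refinement, \<open>a * b \<le> a\<^sup>2 + b\<^sup>2 / 4\<close> trades half of the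
  quadratic term against the noise, at the price of \<open>T\<close> for each cell.\<close>

lemma lik_ratio_upper:
  assumes y: "y \<in> regular_noise n f0 T" and n: "1 \<le> n" and T: "0 \<le> T"
    and U: "U \<subseteq> split_candidates n" and U0: "U0 \<subseteq> split_candidates n"
    and f: "\<And>x. x \<in> {0<..1} \<Longrightarrow> f x = step_fun (cells U) b x"
    and f0: "\<And>x. x \<in> {0<..1} \<Longrightarrow> f0 x = step_fun (cells U0) b0 x"
  shows "lik_ratio n f0 f y \<le>
    exp (T * real (Suc (card U) + Suc (card U0)) - real n * (emp_norm n (\<lambda>x. f x - f0 x))\<^sup>2 / 4)"
proof -
  let ?W = "U \<union> U0"
  have W: "?W \<subseteq> split_candidates n" using U U0 by auto
  have fin: "finite U" "finite U0" "finite ?W"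
    using U U0 W by (blast intro: finite_subset_split_candidates)+
  have sub: "U \<subseteq> {0<..<1}" "U0 \<subseteq> {0<..<1}" "?W \<subseteq> {0<..<1}"
    using U U0 split_candidates_subset by blast+
  \<comment> \<open>the common value of the difference on a cell of the refinement, read off at an arbitrary design point; cells without design points contribute nothing\<close>
  define d where "d k = (let i = (SOME i. i \<in> points_in n (cells ?W ! k))
                          in f (design n i) - f0 (design n i))" for k
  have d: "f (design n i) - f0 (design n i) = d k" if k: "k \<le> card ?W" and i: "i \<in> points_in n (cells ?W ! k)" for k i
  proof -
    define j where "j = (SOME i. i \<in> points_in n (cells ?W ! k))"
    have j: "j \<in> points_in n (cells ?W ! k)" unfolding j_def using i by (rule someI)
    have ij: "design n i \<in> cells ?W ! k" "design n j \<in> cells ?W ! k"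
      using i j by (auto simp: points_in_def)
    hence "design n i \<in> {0<..1}" "design n j \<in> {0<..1}"
      using cells_subset[OF fin(3) sub(3) k] by blast+
    moreover have "step_fun (cells U) b (design n i) = step_fun (cells U) b (design n j)"
      by (rule step_fun_constant_on_refinement[OF fin(1) sub(1) fin(2) sub(2) k ij])
    moreover have "step_fun (cells U0) b0 (design n i) = step_fun (cells U0) b0 (design n j)"
      by (rule step_fun_constant_on_refinement[OF fin(2) sub(2) fin(1) sub(1), of k])
         (use k ij in \<open>simp_all only: Un_commute[of U0 U]\<close>)
    ultimately have "f (design n i) - f0 (design n i) = f (design n j) - f0 (design n j)"
      by (simp only: f f0)
    thus ?thesis by (simp only: d_def Let_def j_def)
  qed
  let ?m = "\<lambda>k. real (card (points_in n (cells ?W ! k)))"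
  let ?S = "\<lambda>k. centred_sum n f0 (cells ?W ! k) y"
  have term_le: "d k * ?S k - (d k)\<^sup>2 * ?m k / 2 \<le> T - (d k)\<^sup>2 * ?m k / 4" if "k \<le> card ?W" for k
  proof -
    have "d k * ?S k \<le> \<bar>d k\<bar> * \<bar>?S k\<bar>" using abs_ge_self[of "d k * ?S k"] by (simp only: abs_mult)
    also have "\<dots> \<le> \<bar>d k\<bar> * sqrt (T * ?m k)"
      using regular_noise_cell[OF y W that n] by (intro mult_left_mono) auto
    also have "\<dots> = sqrt T * (\<bar>d k\<bar> * sqrt (?m k))" by (simp add: real_sqrt_mult)
    also have "\<dots> \<le> (sqrt T)\<^sup>2 + (\<bar>d k\<bar> * sqrt (?m k))\<^sup>2 / 4"
    proof -
      have "0 \<le> (sqrt T - \<bar>d k\<bar> * sqrt (?m k) / 2)\<^sup>2" by simp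
      thus ?thesis unfolding power2_diff power_divide by simp
    qed
    also have "\<dots> = T + (d k)\<^sup>2 * ?m k / 4" using T by (simp add: power_mult_distrib)
    finally show ?thesis by simp
  qed
  have "lik_ratio n f0 f y = exp (\<Sum>k\<le>card ?W. d k * ?S k - (d k)\<^sup>2 * ?m k / 2)"
    by (rule lik_ratio_constant_on_cells(1)[OF fin(3) sub(3)]) (rule d)
  also have "\<dots> \<le> exp (\<Sum>k\<le>card ?W. T - (d k)\<^sup>2 * ?m k / 4)"
    unfolding exp_le_cancel_iff by (intro sum_mono term_le) simp
  also have "(\<Sum>k\<le>card ?W. T - (d k)\<^sup>2 * ?m k / 4) =
      T * real (Suc (card ?W)) - (\<Sum>k\<le>card ?W. (d k)\<^sup>2 * ?m k) / 4"
    by (simp add: sum_subtractf sum_divide_distrib algebra_simps)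
  also have "(\<Sum>k\<le>card ?W. (d k)\<^sup>2 * ?m k) = real n * (emp_norm n (\<lambda>x. f x - f0 x))\<^sup>2"
    unfolding emp_norm_sq[OF n]
    by (rule lik_ratio_constant_on_cells(2)[OF fin(3) sub(3), symmetric]) (rule d)
  also have "exp (T * real (Suc (card ?W)) - real n * (emp_norm n (\<lambda>x. f x - f0 x))\<^sup>2 / 4) \<le>
    exp (T * real (Suc (card U) + Suc (card U0)) - real n * (emp_norm n (\<lambda>x. f x - f0 x))\<^sup>2 / 4)"
    using T card_Un_le[of U U0] by (simp add: mult_left_mono)
  finally show ?thesis .
qed

lemma std_normal_small_interval_ge:
  assumes "\<bar>c\<bar> \<le> B" and r: "0 < r" "r \<le> 1"
  shows "ennreal (r * exp (- B\<^sup>2 - 2)) \<le> (\<integral>\<^sup>+t. indicator {t. \<bar>t - c\<bar> \<le> r} t \<partial>gauss 0)"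
proof -
  have eq: "{t. \<bar>t - c\<bar> \<le> r} = {c - r .. c + r}" by auto
  have dens: "exp (- B\<^sup>2 - 2) / 2 \<le> std_normal_density t" if t: "t \<in> {c - r .. c + r}" for t
  proof -
    have "\<bar>t\<bar> \<le> B + 1" using t r assms by auto
    hence "t\<^sup>2 \<le> (B + 1)\<^sup>2" using assms(1) by (simp add: abs_le_square_iff[symmetric])
    also have "\<dots> \<le> 2 * B\<^sup>2 + 2" using zero_le_power2[of "B - 1"] by (simp add: power2_eq_square algebra_simps)
    finally have t2: "exp (- B\<^sup>2 - 1) \<le> exp (- t\<^sup>2 / 2)" by simp
    have "sqrt (2 * pi) \<le> sqrt (4\<^sup>2)" using pi_less_4 by (intro real_sqrt_le_mono) simp
    hence "sqrt (2 * pi) \<le> 4" by simp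
    hence q: "1 / 4 \<le> 1 / sqrt (2 * pi)" by (intro divide_left_mono) auto
    have "exp (- 1) \<le> (1 / 2 :: real)"
      using exp_ge_add_one_self[of "1 :: real"] by (simp add: exp_minus field_simps)
    hence "exp (- B\<^sup>2 - 1) * exp (- 1) \<le> exp (- B\<^sup>2 - 1) * (1 / 2)" by (intro mult_left_mono) auto
    moreover have "exp (- B\<^sup>2 - 1) * exp (- 1) = exp (- B\<^sup>2 - 2)"
      unfolding exp_add[symmetric] by simp
    ultimately have "exp (- B\<^sup>2 - 2) / 2 \<le> 1 / 4 * exp (- B\<^sup>2 - 1)" by linarith
    also have "\<dots> \<le> 1 / sqrt (2 * pi) * exp (- t\<^sup>2 / 2)" using q t2 by (intro mult_mono) auto
    also have "\<dots> = std_normal_density t" by (simp add: std_normal_density_def)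
    finally show ?thesis .
  qed
  have "ennreal (r * exp (- B\<^sup>2 - 2)) = ennreal (exp (- B\<^sup>2 - 2) / 2) * ennreal ((c + r) - (c - r))"
    using r by (simp add: ennreal_mult[symmetric] mult.commute)
  also have "\<dots> = (\<integral>\<^sup>+t. ennreal (exp (- B\<^sup>2 - 2) / 2) * indicator {c - r .. c + r} t \<partial>lborel)"
    using r by (subst nn_integral_cmult) auto
  also have "\<dots> \<le> (\<integral>\<^sup>+t. ennreal (std_normal_density t) * indicator {c - r .. c + r} t \<partial>lborel)"
    using dens by (intro nn_integral_mono) (auto simp: indicator_def intro!: ennreal_leI)
  also have "\<dots> = (\<integral>\<^sup>+t. indicator {t. \<bar>t - c\<bar> \<le> r} t \<partial>gauss 0)"
    unfolding eq by (subst nn_integral_density) auto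
  finally show ?thesis .
qed

lemma card_points_in_le: "card (points_in n V) \<le> n"
proof -
  have "card (points_in n V) \<le> card {1..n}" by (rule card_mono) (auto simp: points_in_def)
  thus ?thesis by simp
qed

text \<open>The evidence of a partition that supports the truth: heights within \<open>1 / sqrt n\<close> of the true
  ones have a likelihood ratio of at least \<open>exp (- sqrt T - 1 / 2)\<close> for each cell, and the prior
  probability of such heights is at least of order \<open>exp (- B\<^sup>2) / sqrt n\<close> for each cell.\<close>

lemma marginal_lower:
  assumes y: "y \<in> regular_noise n f0 T" and n: "1 \<le> n" and T: "0 \<le> T"
    and U: "U \<subseteq> split_candidates n"
    and f0: "\<And>x. x \<in> {0<..1} \<Longrightarrow> f0 x = step_fun (cells U) b0 x"
    and B: "\<And>k. k \<le> card U \<Longrightarrow> \<bar>b0 k\<bar> \<le> B"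
  shows "ennreal (exp (- real (Suc (card U)) * (ln (real n) / 2 + B\<^sup>2 + 2 + sqrt T + 1 / 2)))
    \<le> (\<integral>\<^sup>+b. ennreal (lik_ratio n f0 (step_fun (cells U) b) y) \<partial>heights_prior (Suc (card U)))"
proof -
  let ?K = "Suc (card U)"
  let ?H = "heights_prior ?K"
  have fin: "finite U" using U by (rule finite_subset_split_candidates)
  have sub: "U \<subseteq> {0<..<1}" using U split_candidates_subset by blast
  define r where "r = 1 / sqrt (real n)"
  have r: "0 < r" "r \<le> 1" using n by (auto simp: r_def)
  have r_exp: "r = exp (- ln (real n) / 2)"
    using n by (simp add: r_def ln_sqrt[symmetric] exp_minus inverse_eq_divide)
  let ?m = "\<lambda>k. real (card (points_in n (cells U ! k)))"
  let ?S = "\<lambda>k. centred_sum n f0 (cells U ! k) y"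
  let ?J = "\<lambda>k. {t. \<bar>t - b0 k\<bar> \<le> r}"
  define c where "c = exp (- real ?K * (sqrt T + 1 / 2))"
  have lower: "ennreal c * (\<Prod>k<?K. indicator (?J k) (b k)) \<le> ennreal (lik_ratio n f0 (step_fun (cells U) b) y)"
    for b
  proof (cases "\<forall>k<?K. b k \<in> ?J k")
    case False
    then obtain k where "k < ?K" "b k \<notin> ?J k" by blast
    hence "(\<Prod>k<?K. indicator (?J k) (b k)) = (0 :: ennreal)"
      by (intro prod_zero) (auto simp: indicator_def)
    thus ?thesis by (simp only: mult_zero_right zero_le)
  next
    case True
    have diff: "step_fun (cells U) b (design n i) - f0 (design n i) = b k - b0 k"
      if k: "k \<le> card U" and i: "i \<in> points_in n (cells U ! k)" for k i
    proof -
      have x: "design n i \<in> cells U ! k" using i by (simp add: points_in_def)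
      hence "design n i \<in> {0<..1}" using cells_subset[OF fin sub k] by blast
      thus ?thesis by (simp add: f0 step_fun_cells[OF fin sub k x])
    qed
    have term_ge: "- (sqrt T + 1 / 2) \<le> (b k - b0 k) * ?S k - (b k - b0 k)\<^sup>2 * ?m k / 2"
      if k: "k \<le> card U" for k
    proof -
      have h: "\<bar>b k - b0 k\<bar> \<le> r" using True k by auto
      have m: "?m k \<le> real n" using card_points_in_le by simp
      have rm: "r * sqrt (?m k) \<le> 1" using m n by (simp add: r_def real_sqrt_le_mono)
      have "\<bar>(b k - b0 k) * ?S k\<bar> \<le> r * sqrt (T * ?m k)"
        unfolding abs_mult using h regular_noise_cell[OF y U k n] r by (intro mult_mono) auto
      also have "\<dots> = sqrt T * (r * sqrt (?m k))" by (simp add: real_sqrt_mult)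
      also have "\<dots> \<le> sqrt T * 1" using rm T by (intro mult_left_mono) auto
      finally have 1: "- sqrt T \<le> (b k - b0 k) * ?S k" by simp
      have "(b k - b0 k)\<^sup>2 \<le> r\<^sup>2" using h r by (simp add: abs_le_square_iff[symmetric])
      hence "(b k - b0 k)\<^sup>2 * ?m k \<le> r\<^sup>2 * real n" using m by (intro mult_mono) auto
      also have "\<dots> = 1" using n by (simp add: r_def power_divide)
      finally show ?thesis using 1 by simp
    qed
    have "c = exp (\<Sum>k\<le>card U. - (sqrt T + 1 / 2))" by (simp add: c_def algebra_simps)
    also have "\<dots> \<le> exp (\<Sum>k\<le>card U. (b k - b0 k) * ?S k - (b k - b0 k)\<^sup>2 * ?m k / 2)"
      unfolding exp_le_cancel_iff by (intro sum_mono term_ge) simp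
    also have "\<dots> = lik_ratio n f0 (step_fun (cells U) b) y"
      by (rule lik_ratio_constant_on_cells(1)[OF fin sub, symmetric]) (rule diff)
    finally have "ennreal c \<le> ennreal (lik_ratio n f0 (step_fun (cells U) b) y)" by (rule ennreal_leI)
    moreover have "(\<Prod>k<?K. indicator (?J k) (b k)) \<le> (1 :: ennreal)"
      unfolding prod_indicator[OF finite_lessThan] by simp
    ultimately show ?thesis
      using mult_mono[of "ennreal c" _ "\<Prod>k<?K. indicator (?J k) (b k)" 1] by simp
  qed
  have "exp (- real ?K * (ln (real n) / 2 + B\<^sup>2 + 2 + sqrt T + 1 / 2)) =
      c * (\<Prod>k<?K. r * exp (- B\<^sup>2 - 2))"
    unfolding r_exp c_def exp_add[symmetric] prod_constant card_lessThan exp_of_nat_mult[symmetric]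
    by (simp add: algebra_simps add_divide_distrib diff_divide_distrib)
  hence "ennreal (exp (- real ?K * (ln (real n) / 2 + B\<^sup>2 + 2 + sqrt T + 1 / 2))) =
      ennreal c * (\<Prod>k<?K. ennreal (r * exp (- B\<^sup>2 - 2)))"
    using r by (subst prod_ennreal) (auto simp: c_def ennreal_mult[symmetric])
  also have "\<dots> \<le> ennreal c * (\<Prod>k<?K. \<integral>\<^sup>+t. indicator (?J k) t \<partial>gauss 0)"
    using B r by (intro mult_left_mono prod_mono_ennreal std_normal_small_interval_ge) auto
  also have "\<dots> = ennreal c * (\<integral>\<^sup>+b. (\<Prod>k<?K. indicator (?J k) (b k)) \<partial>?H)"
  proof -
    have "(indicator (?J k) :: real \<Rightarrow> ennreal) \<in> borel_measurable borel" for k by measurable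
    from nn_integral_heights_prior_prod[where K = ?K and g = "\<lambda>k. indicator (?J k)", OF this]
    show ?thesis by (simp only:)
  qed
  also have "\<dots> = (\<integral>\<^sup>+b. ennreal c * (\<Prod>k<?K. indicator (?J k) (b k)) \<partial>?H)"
  proof (rule nn_integral_cmult[symmetric])
    have "(\<lambda>b. indicator (?J k) (b k) :: ennreal) \<in> borel_measurable ?H" if "k < ?K" for k
    proof (rule measurable_compose[where N = borel and f = "\<lambda>b. b k"])
      show "(\<lambda>b. b k) \<in> borel_measurable ?H"
        using that unfolding measurable_cong_sets[OF sets_heights_prior refl]
        by (intro measurable_component_singleton) simp
    qed measurable
    thus "(\<lambda>b. \<Prod>k<?K. indicator (?J k) (b k) :: ennreal) \<in> borel_measurable ?H"
      by (intro borel_measurable_prod_ennreal) auto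
  qed
  also have "\<dots> \<le> (\<integral>\<^sup>+b. ennreal (lik_ratio n f0 (step_fun (cells U) b) y) \<partial>?H)"
    by (intro nn_integral_mono lower)
  finally show ?thesis .
qed

section \<open>The complexity is attained\<close>

lemma interval_partition_disjoint:
  assumes "interval_partition P" "i < length P" "j < length P" "i \<noteq> j"
  shows "P ! i \<inter> P ! j = {}"
proof (rule disjointD)
  show "disjoint (set P)" using assms(1) by (simp add: interval_partition_def partition_on_def)
  show "P ! i \<noteq> P ! j" using assms by (simp add: interval_partition_def nth_eq_iff_index_eq)
qed (use assms in simp_all)

lemma step_fun_interval_partition:
  assumes "interval_partition P" "k < length P" "x \<in> P ! k"
  shows "step_fun P b x = b k"
proof -
  have "x \<in> P ! j \<longleftrightarrow> j = k" if "j < length P" for j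
  proof
    assume "x \<in> P ! j"
    thus "j = k" using interval_partition_disjoint[OF assms(1) that assms(2)] assms(3) by blast
  qed (use assms in simp)
  hence "step_fun P b x = (\<Sum>j<length P. if j = k then b j else 0)"
    unfolding step_fun_def by (intro sum.cong) (auto simp: indicator_def)
  thus ?thesis using assms by simp
qed

lemma interval_partition_cover:
  assumes "interval_partition P" "x \<in> {0..1}"
  obtains k where "k < length P" "x \<in> P ! k"
proof -
  have "x \<in> \<Union>(set P)" using assms by (simp add: interval_partition_def partition_on_def)
  thus thesis using that by (auto simp: in_set_conv_nth)
qed

text \<open>If \<open>f\<close> is constant on an interval \<open>V\<close>, then \<open>f\<close> is also constant on the union of all cells that
  meet \<open>V\<close>, and this union is an interval. Replacing these cells by their union gives another
  representation, which would be shorter if \<open>V\<close> met two cells.\<close>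

lemma minimal_representation_one_cell:
  assumes min: "minimal_representation P0 b0 f"
    and V: "V \<subseteq> {0..1}" "is_interval V" "V \<noteq> {}"
    and const: "\<And>x. x \<in> V \<Longrightarrow> f x = c"
  shows "num_met V P0 = 1"
proof (rule ccontr)
  assume not1: "num_met V P0 \<noteq> 1"
  have P0: "interval_partition P0" and f: "\<And>x. x \<in> {0..1} \<Longrightarrow> f x = step_fun P0 b0 x"
    using min by (auto simp: minimal_representation_def represents_def)
  have dist: "distinct P0" using P0 by (simp add: interval_partition_def)
  note disj = interval_partition_disjoint[OF P0]
  have ne: "P0 ! j \<noteq> {}" if "j < length P0" for j
    using P0 nth_mem[OF that] unfolding interval_partition_def partition_on_def by metis
  have sub: "P0 ! j \<subseteq> {0..1}" if "j < length P0" for j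
    using P0 that nth_mem[of j P0] by (auto simp: interval_partition_def partition_on_def)
  \<comment> \<open>the cells to be merged\<close>
  define J where "J = {j. j < length P0 \<and> P0 ! j \<inter> V \<noteq> {}}"
  have J_less: "j < length P0" if "j \<in> J" for j using that by (simp add: J_def)
  have finJ: "finite J" by (simp add: J_def)
  obtain v where v: "v \<in> V" using V by auto
  obtain j0 where "j0 < length P0" "v \<in> P0 ! j0"
    using interval_partition_cover[OF P0 subsetD[OF V(1) v]] .
  hence j0: "j0 \<in> J" using v by (auto simp: J_def)
  have "card J \<noteq> 0" using j0 finJ by auto
  hence card_J: "2 \<le> card J" using not1 by (simp add: num_met_def J_def[symmetric])

  define W where "W = (\<Union>j\<in>J. P0 ! j)"
  have V_W: "V \<subseteq> W"
  proof
    fix x assume x: "x \<in> V"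
    obtain j where "j < length P0" "x \<in> P0 ! j"
      using interval_partition_cover[OF P0 subsetD[OF V(1) x]] .
    thus "x \<in> W" using x by (auto simp: W_def J_def)
  qed
  have "connected (\<Union>j\<in>J. P0 ! j \<union> V)"
  proof (rule connected_Union)
    show "\<Inter> ((\<lambda>j. P0 ! j \<union> V) ` J) \<noteq> {}" using v by auto
    fix S assume "S \<in> (\<lambda>j. P0 ! j \<union> V) ` J"
    then obtain j where j: "j \<in> J" "S = P0 ! j \<union> V" by auto
    have "is_interval (P0 ! j)" using P0 J_less[OF j(1)] nth_mem[of j P0] by (auto simp: interval_partition_def)
    hence "connected (P0 ! j)" "connected V" using V(2) by (simp_all only: is_interval_connected_1)
    moreover have "P0 ! j \<inter> V \<noteq> {}" using j(1) by (simp add: J_def)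
    ultimately show "connected S" unfolding j(2) by (rule connected_Un)
  qed
  moreover have "(\<Union>j\<in>J. P0 ! j \<union> V) = W" using V_W j0 unfolding W_def by blast
  ultimately have W_int: "is_interval W" by (simp add: is_interval_connected_1)
  have W_const: "f x = c" if "x \<in> W" for x
  proof -
    obtain j where j: "j \<in> J" "x \<in> P0 ! j" using \<open>x \<in> W\<close> by (auto simp: W_def)
    then obtain w where w: "w \<in> P0 ! j" "w \<in> V" by (auto simp: J_def)
    have "x \<in> {0..1}" "w \<in> {0..1}" using sub[OF J_less[OF j(1)]] j w by blast+
    hence "f x = b0 j" "f w = b0 j"
      using step_fun_interval_partition[OF P0 J_less[OF j(1)]] j(2) w(1) f by simp_all
    thus ?thesis using const[OF w(2)] by simp
  qed

  define ks where "ks = filter (\<lambda>j. j \<notin> J) [0..<length P0]"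
  have set_ks: "set ks = {..<length P0} - J" by (auto simp: ks_def)
  have ks_less: "ks ! i < length P0" "ks ! i \<notin> J" if "i < length ks" for i
    using nth_mem[OF that] set_ks by auto
  have "length ks = card (set ks)" by (rule distinct_card[symmetric]) (simp add: ks_def)
  also have "\<dots> = length P0 - card J"
    unfolding set_ks using card_Diff_subset[OF finJ, of "{..<length P0}"] J_less by force
  finally have len_ks: "length ks = length P0 - card J" .
  \<comment> \<open>the merged cell comes first, followed by the cells that do not meet \<open>V\<close>\<close>
  define P' where "P' = W # map ((!) P0) ks"
  define b' where "b' = case_nat c (\<lambda>i. b0 (ks ! i))"
  have W_ks: "W \<inter> P0 ! j = {}" if "j \<in> set ks" for j
  proof -
    have "P0 ! i \<inter> P0 ! j = {}" if "i \<in> J" for i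
    proof (rule disj)
      show "i < length P0" using that by (rule J_less)
      have "j \<in> {..<length P0} - J" using \<open>j \<in> set ks\<close> set_ks by simp
      thus "j < length P0" "i \<noteq> j" using that by auto
    qed
    thus ?thesis by (auto simp: W_def)
  qed
  have W_ne: "W \<noteq> {}" using v V_W by auto
  have part: "interval_partition P'"
    unfolding interval_partition_def partition_on_def
  proof (intro conjI)
    have "inj_on ((!) P0) (set ks)"
      using dist set_ks by (auto simp: inj_on_def nth_eq_iff_index_eq)
    moreover have "W \<notin> (!) P0 ` set ks"
    proof
      assume "W \<in> (!) P0 ` set ks"
      then obtain j where "j \<in> set ks" "W = P0 ! j" by blast
      thus False using W_ks[of j] W_ne by blast
    qed
    ultimately show "distinct P'" by (auto simp: P'_def distinct_map ks_def)
    have "(\<Union>j<length P0. P0 ! j) = {0..1}"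
    proof (intro equalityI subsetI)
      fix x :: real assume "x \<in> {0..1}"
      then obtain k where "k < length P0" "x \<in> P0 ! k" by (rule interval_partition_cover[OF P0])
      thus "x \<in> (\<Union>j<length P0. P0 ! j)" by blast
    next
      fix x assume "x \<in> (\<Union>j<length P0. P0 ! j)"
      then obtain j where "j < length P0" "x \<in> P0 ! j" by blast
      thus "x \<in> {0..1}" using sub by blast
    qed
    moreover have "\<Union> (set P') = (\<Union>j\<in>J \<union> set ks. P0 ! j)" by (simp add: P'_def W_def)
    moreover have "J \<union> set ks = {..<length P0}" using set_ks J_less by auto
    ultimately show "\<Union> (set P') = {0..1}" by simp
    show "disjoint (set P')"
    proof (rule disjointI)
      fix A B assume AB: "A \<in> set P'" "B \<in> set P'" "A \<noteq> B"
      have *: "P0 ! i \<inter> P0 ! j = {}" if "i \<in> set ks" "j \<in> set ks" "P0 ! i \<noteq> P0 ! j" for i j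
      proof (rule disj)
        have "i \<in> {..<length P0} - J" "j \<in> {..<length P0} - J" using that(1,2) set_ks by simp_all
        thus "i < length P0" "j < length P0" by auto
        show "i \<noteq> j" using that(3) by blast
      qed
      show "A \<inter> B = {}"
      proof (cases "A = W")
        case True
        hence "B \<in> (!) P0 ` set ks" using AB(2,3) by (simp add: P'_def)
        then obtain j where "j \<in> set ks" "B = P0 ! j" by blast
        thus ?thesis using W_ks[of j] True by blast
      next
        case False
        hence "A \<in> (!) P0 ` set ks" using AB(1) by (simp add: P'_def)
        then obtain i where i: "i \<in> set ks" "A = P0 ! i" by blast
        show ?thesis
        proof (cases "B = W")
          case True
          thus ?thesis using W_ks[OF i(1)] i(2) by blast
        next
          case False
          hence "B \<in> (!) P0 ` set ks" using AB(2) by (simp add: P'_def)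
          then obtain j where j: "j \<in> set ks" "B = P0 ! j" by blast
          have "P0 ! i \<noteq> P0 ! j" using AB(3) i(2) j(2) by simp
          from *[OF i(1) j(1) this] show ?thesis unfolding i(2) j(2) .
        qed
      qed
    qed
    show "{} \<notin> set P'" using W_ne ne set_ks by (auto simp: P'_def)
    show "\<forall>V\<in>set P'. is_interval V"
      using W_int P0 set_ks nth_mem[of _ P0] by (auto simp: P'_def interval_partition_def)
  qed
  have "f x = step_fun P' b' x" if x: "x \<in> {0..1}" for x
  proof -
    obtain k where k: "k < length P'" "x \<in> P' ! k" using interval_partition_cover[OF part x] .
    have "step_fun P' b' x = b' k" by (rule step_fun_interval_partition[OF part k])
    also have "\<dots> = f x"
    proof (cases k)
      case 0
      thus ?thesis using k W_const by (simp add: P'_def b'_def)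
    next
      case (Suc i)
      hence i: "i < length ks" "x \<in> P0 ! (ks ! i)" using k by (auto simp: P'_def)
      thus ?thesis using Suc f[OF x] step_fun_interval_partition[OF P0 ks_less(1)[OF i(1)] i(2)]
        by (simp add: b'_def)
    qed
    finally show ?thesis ..
  qed
  hence "represents P' b' f" using part by (simp add: represents_def)
  hence "length P0 \<le> length P'" using min unfolding minimal_representation_def by blast
  moreover have "card J \<le> length P0"
    using card_mono[of "{..<length P0}" J] J_less by auto
  ultimately show False using card_J by (simp add: P'_def len_ks)
qed

lemma BI_cells:
  assumes "P \<in> BI n Cmin Cmax"
  obtains U where "U \<subseteq> split_candidates n" "P = cells U" "P \<in> BI_K n Cmin Cmax (length P)"
proof -
  obtain K where K: "P \<in> BI_K n Cmin Cmax K" using assms by (auto simp: BI_def)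
  hence "length P = K" by (rule length_BI_K)
  show thesis using K
  proof (rule BI_K_cells)
    fix U assume "U \<subseteq> split_candidates n" "P = cells U"
    thus thesis using that K \<open>length P = K\<close> by blast
  qed
qed

text \<open>A balanced partition that supports \<open>f\<close> has cells on which \<open>f\<close> is constant, so by
  \<open>minimal_representation_one_cell\<close> each of them meets exactly one cell of the minimal
  representation. Hence the minimum in the
  definition of the complexity ranges over a nonempty set. On a partition attaining it, the step
  heights of \<open>f\<close> are taken from those of the minimal representation and inherit their bound.\<close>

lemma complexity_attained:
  assumes min: "minimal_representation P0 b0 f"
    and supp: "supported_on_class (BI n Cmin Cmax) f"
  obtains U b where "U \<subseteq> split_candidates n"
    "Suc (card U) = complexity P0 (BI n Cmin Cmax)"
    "cells U \<in> BI_K n Cmin Cmax (Suc (card U))"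
    "\<And>x. x \<in> {0<..1} \<Longrightarrow> f x = step_fun (cells U) b x"
    "\<And>k. k \<le> card U \<Longrightarrow> \<bar>b k\<bar> \<le> sup_norm (length P0) b0"
proof -
  have P0: "interval_partition P0" and f: "\<And>x. x \<in> {0..1} \<Longrightarrow> f x = step_fun P0 b0 x"
    using min by (auto simp: minimal_representation_def represents_def)
  obtain P b1 where P: "P \<in> BI n Cmin Cmax" and fP: "\<And>x. x \<in> {0<..1} \<Longrightarrow> f x = step_fun P b1 x"
    using supp unfolding supported_on_class_def by blast
  obtain U1 where U1: "U1 \<subseteq> split_candidates n" "P = cells U1" using BI_cells[OF P] .
  have fin1: "finite U1" using U1(1) by (rule finite_subset_split_candidates)
  have sub1: "U1 \<subseteq> {0<..<1}" using U1(1) split_candidates_subset by blast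
  have "num_met V P0 = 1" if "V \<in> set P" for V
  proof -
    obtain k where "k < length (cells U1)" "cells U1 ! k = V"
      using \<open>V \<in> set P\<close> unfolding U1(2) in_set_conv_nth by blast
    hence k: "k \<le> card U1" "V = cells U1 ! k" by (simp_all only: length_cells less_Suc_eq_le)
    have V: "V = {breaks U1 ! k <.. breaks U1 ! Suc k}" using k by (simp add: cells_nth)
    have "breaks U1 ! k < breaks U1 ! Suc k" using breaks_less[OF fin1 sub1, of k "Suc k"] k(1) by simp
    hence "V \<noteq> {}" by (simp add: V)
    moreover have V01: "V \<subseteq> {0<..1}" using cells_subset[OF fin1 sub1 k(1)] k(2) by simp
    hence "V \<subseteq> {0..1}" by auto
    moreover have "is_interval V" by (simp add: V is_interval_oc)
    moreover have "f x = b1 k" if x: "x \<in> V" for x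
    proof -
      have "x \<in> {0<..1}" using V01 x by blast
      thus ?thesis using fP U1(2) step_fun_cells[OF fin1 sub1 k(1)] x k(2) by simp
    qed
    ultimately show ?thesis by (intro minimal_representation_one_cell[OF min])
  qed
  hence "\<exists>K. \<exists>P\<in>BI n Cmin Cmax. length P = K \<and> (\<forall>V\<in>set P. num_met V P0 = 1)"
    using P by blast
  from LeastI_ex[OF this] obtain P2 where P2: "P2 \<in> BI n Cmin Cmax"
    and len: "length P2 = complexity P0 (BI n Cmin Cmax)"
    and met: "\<And>V. V \<in> set P2 \<Longrightarrow> num_met V P0 = 1"
    unfolding complexity_def by blast
  obtain U where U: "U \<subseteq> split_candidates n" "P2 = cells U" "P2 \<in> BI_K n Cmin Cmax (length P2)"
    using BI_cells[OF P2] .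
  have fin: "finite U" using U(1) by (rule finite_subset_split_candidates)
  have sub: "U \<subseteq> {0<..<1}" using U(1) split_candidates_subset by blast
  have "\<exists>j<length P0. cells U ! k \<subseteq> P0 ! j" if k: "k \<le> card U" for k
  proof -
    have "cells U ! k \<in> set P2" unfolding U(2) using k by (intro nth_mem) simp
    hence "num_met (cells U ! k) P0 = 1" by (rule met)
    then obtain j where j: "{j. j < length P0 \<and> P0 ! j \<inter> cells U ! k \<noteq> {}} = {j}"
      unfolding num_met_def by (rule card_1_singletonE)
    have "cells U ! k \<subseteq> P0 ! j"
    proof
      fix x assume x: "x \<in> cells U ! k"
      hence "x \<in> {0<..1}" using cells_subset[OF fin sub k] by blast
      hence "x \<in> {0..1}" by simp
      then obtain i where "i < length P0" "x \<in> P0 ! i" by (rule interval_partition_cover[OF P0])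
      moreover from this have "i \<in> {j}" using x unfolding j[symmetric] by blast
      ultimately show "x \<in> P0 ! j" by simp
    qed
    thus ?thesis using j by blast
  qed
  hence "\<forall>k. \<exists>j. k \<le> card U \<longrightarrow> j < length P0 \<and> cells U ! k \<subseteq> P0 ! j" by blast
  from choice[OF this] obtain j where "\<forall>k. k \<le> card U \<longrightarrow> j k < length P0 \<and> cells U ! k \<subseteq> P0 ! j k"
    by blast
  hence j: "\<And>k. k \<le> card U \<Longrightarrow> j k < length P0"
    "\<And>k. k \<le> card U \<Longrightarrow> cells U ! k \<subseteq> P0 ! j k" by simp_all
  show thesis
  proof (rule that[of U "\<lambda>k. b0 (j k)"])
    show "U \<subseteq> split_candidates n" by (rule U(1))
    show "Suc (card U) = complexity P0 (BI n Cmin Cmax)" using len U(2) by simp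
    show "cells U \<in> BI_K n Cmin Cmax (Suc (card U))" using U(2,3) by simp
    show "f x = step_fun (cells U) (\<lambda>k. b0 (j k)) x" if x: "x \<in> {0<..1}" for x
    proof -
      obtain k where k: "k \<le> card U" "x \<in> cells U ! k" using cells_cover[OF fin sub x] .
      have "f x = step_fun P0 b0 x" by (rule f) (use x in simp)
      also have "\<dots> = b0 (j k)"
        by (rule step_fun_interval_partition[OF P0 j(1)[OF k(1)] subsetD[OF j(2)[OF k(1)] k(2)]])
      also have "\<dots> = step_fun (cells U) (\<lambda>k. b0 (j k)) x"
        using step_fun_cells[OF fin sub k] by simp
      finally show ?thesis .
    qed
    show "\<bar>b0 (j k)\<bar> \<le> sup_norm (length P0) b0" if "k \<le> card U" for k
      unfolding sup_norm_def
    proof (rule Max_ge)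
      show "\<bar>b0 (j k)\<bar> \<in> (\<lambda>k. \<bar>b0 k\<bar>) ` {..<length P0}"
        by (rule image_eqI[of _ _ "j k"]) (simp_all add: j(1)[OF that])
    qed simp
  qed
qed

section \<open>A bound for fixed sample size\<close>

context balanced_prior
begin

lemma avg_le:
  assumes "\<And>P. P \<in> parts K \<Longrightarrow> (\<integral>\<^sup>+b. g (step_fun P b) \<partial>heights_prior K) \<le> c" "K \<in> adm"
  shows "avg K g \<le> c"
proof -
  have card: "0 < card (parts K)" using admD(2)[OF assms(2)] finite_BI_K by (simp add: card_gt_0_iff)
  have "avg K g \<le> (\<Sum>P\<in>parts K. ennreal (1 / real (card (parts K))) * c)"
    unfolding partition_average_def by (intro sum_mono mult_left_mono assms(1)) simp_all
  also have "\<dots> = (of_nat (card (parts K)) * ennreal (1 / real (card (parts K)))) * c"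
    by (simp only: sum_constant mult.assoc)
  also have "of_nat (card (parts K)) * ennreal (1 / real (card (parts K))) = 1"
    using card by (simp add: ennreal_of_nat_eq_real_of_nat ennreal_mult[symmetric])
  finally show ?thesis by simp
qed

lemma avg_mono:
  assumes "\<And>f. g f \<le> h f"
  shows "avg K g \<le> avg K h"
  unfolding partition_average_def by (intro sum_mono mult_left_mono nn_integral_mono assms) simp

lemma heights_integral_le:
  assumes "\<And>b. g (step_fun P b) \<le> c"
  shows "(\<integral>\<^sup>+b. g (step_fun P b) \<partial>heights_prior K) \<le> c"
proof -
  interpret prob_space "heights_prior K" by (rule prob_space_heights_prior)
  have "(\<integral>\<^sup>+b. g (step_fun P b) \<partial>heights_prior K) \<le> (\<integral>\<^sup>+b. c \<partial>heights_prior K)"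
    by (intro nn_integral_mono assms)
  thus ?thesis by (simp add: emeasure_space_1)
qed

lemma marginal_measurable:
  assumes "P \<in> parts K"
  shows "(\<lambda>y. \<integral>\<^sup>+b. ennreal (lik_ratio n f0 (step_fun P b) y) \<partial>heights_prior K)
    \<in> borel_measurable (data_law n f0)"
proof -
  interpret prob_space "heights_prior K" by (rule prob_space_heights_prior)
  have [measurable]: "(\<lambda>(b, y). lik_ratio n f0 (step_fun P b) y) \<in>
    borel_measurable ((\<Pi>\<^sub>M k\<in>{..<K}. borel) \<Otimes>\<^sub>M (\<Pi>\<^sub>M i\<in>{1..n}. borel))"
    by (rule lik_ratio_joint_measurable) (rule length_BI_K[OF assms])
  show ?thesis by measurable
qed

lemma avg_lik_ratio_measurable [measurable]:
  "(\<lambda>y. avg K (\<lambda>f. ennreal (lik_ratio n f0 f y))) \<in> borel_measurable (data_law n f0)"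
  unfolding partition_average_def
  by (intro borel_measurable_sum borel_measurable_times_ennreal borel_measurable_const marginal_measurable)

text \<open>Balancedness gives every cell at least \<open>Cmin\<^sup>2 * n / K\<close> design points, so all cells and all
  partitions with \<open>K\<close> cells obey the same bound.\<close>

lemma expected_avg_on_regular_noise:
  assumes K: "K \<in> adm" and T: "0 \<le> T"
  shows "(\<integral>\<^sup>+y. indicator (regular_noise n f0 T) y * avg K (\<lambda>f. ennreal (lik_ratio n f0 f y)) \<partial>data_law n f0)
    \<le> ennreal (sqrt (T * real K / (Cmin\<^sup>2 * real n)) ^ K)"
proof -
  let ?M = "data_law n f0"
  let ?I = "\<lambda>P y. \<integral>\<^sup>+b. ennreal (lik_ratio n f0 (step_fun P b) y) \<partial>heights_prior K"
  let ?c = "ennreal (1 / real (card (parts K)))"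
  let ?q = "sqrt (T * real K / (Cmin\<^sup>2 * real n))"
  have card: "0 < card (parts K)" using admD(2)[OF K] finite_BI_K by (simp add: card_gt_0_iff)
  have meas: "(\<lambda>y. indicator (regular_noise n f0 T) y * ?I P y) \<in> borel_measurable ?M" if "P \<in> parts K" for P
    using marginal_measurable[OF that] by (intro borel_measurable_times_ennreal) simp_all
  have "(\<integral>\<^sup>+y. indicator (regular_noise n f0 T) y * avg K (\<lambda>f. ennreal (lik_ratio n f0 f y)) \<partial>?M)
    = (\<integral>\<^sup>+y. (\<Sum>P\<in>parts K. ?c * (indicator (regular_noise n f0 T) y * ?I P y)) \<partial>?M)"
    unfolding partition_average_def by (intro nn_integral_cong) (simp add: sum_distrib_left mult_ac)
  also have "\<dots> = (\<Sum>P\<in>parts K. \<integral>\<^sup>+y. ?c * (indicator (regular_noise n f0 T) y * ?I P y) \<partial>?M)"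
    by (rule nn_integral_sum) (intro borel_measurable_times_ennreal borel_measurable_const meas)
  also have "\<dots> = (\<Sum>P\<in>parts K. ?c * (\<integral>\<^sup>+y. indicator (regular_noise n f0 T) y * ?I P y \<partial>?M))"
    by (intro sum.cong refl nn_integral_cmult meas)
  also have "\<dots> \<le> (\<Sum>P\<in>parts K. ?c * ennreal (?q ^ K))"
  proof (intro sum_mono mult_left_mono)
    fix P assume P: "P \<in> parts K"
    obtain U where U: "U \<subseteq> split_candidates n" "K = Suc (card U)" "P = cells U"
      "balanced n Cmin Cmax (cells U)" using P by (rule BI_K_cells)
    have m: "Cmin\<^sup>2 * real n / real K \<le> real (card (points_in n (cells U ! k)))" if "k \<le> card U" for k
      using points_in_balanced[OF U(4) that n] U(2) by simp
    have pos: "0 < Cmin\<^sup>2 * real n / real K" using Cmin n U(2) by simp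
    have "(\<integral>\<^sup>+y. indicator (regular_noise n f0 T) y * ?I P y \<partial>?M)
      \<le> (\<Prod>k\<le>card U. ennreal (sqrt (T / real (card (points_in n (cells U ! k))))))"
      unfolding U(2,3)
    proof (rule expected_marginal_on_regular_noise[OF U(1) n T])
      fix k assume "k \<le> card U"
      from less_le_trans[OF pos m[OF this]] show "points_in n (cells U ! k) \<noteq> {}" by auto
    qed
    also have "\<dots> \<le> (\<Prod>k\<le>card U. ennreal ?q)"
    proof (rule prod_mono_ennreal)
      fix k assume "k \<in> {..card U}"
      hence "T / real (card (points_in n (cells U ! k))) \<le> T / (Cmin\<^sup>2 * real n / real K)"
        using m[of k] pos T by (intro divide_left_mono mult_pos_pos) auto
      thus "ennreal (sqrt (T / real (card (points_in n (cells U ! k))))) \<le> ennreal ?q"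
        by (intro ennreal_leI real_sqrt_le_mono) simp
    qed
    also have "\<dots> = ennreal (?q ^ K)" using T by (simp add: U(2) ennreal_power del: power_Suc)
    finally show "(\<integral>\<^sup>+y. indicator (regular_noise n f0 T) y * ?I P y \<partial>?M) \<le> ennreal (?q ^ K)" .
  qed simp
  also have "\<dots> = (of_nat (card (parts K)) * ?c) * ennreal (?q ^ K)"
    by (simp only: sum_constant mult.assoc)
  also have "of_nat (card (parts K)) * ?c = 1"
    using card by (simp add: ennreal_of_nat_eq_real_of_nat ennreal_mult[symmetric])
  finally show ?thesis by simp
qed

end

locale balanced_truth = balanced_prior +
  fixes f0 :: "real \<Rightarrow> real" and U0 :: "real set" and b0 :: "nat \<Rightarrow> real" and B :: real
  assumes U0: "U0 \<subseteq> split_candidates n" "cells U0 \<in> BI_K n Cmin Cmax (Suc (card U0))"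
    and f0: "\<And>x. x \<in> {0<..1} \<Longrightarrow> f0 x = step_fun (cells U0) b0 x"
    and B: "\<And>k. k \<le> card U0 \<Longrightarrow> \<bar>b0 k\<bar> \<le> B"
begin

abbreviation "Ks \<equiv> Suc (card U0)"

lemma Ks_adm: "Ks \<in> adm"
  using U0(2) by (auto simp: admissible_K_def)

text \<open>The product of lower bounds for the prior probability of \<open>Ks\<close>, for the prior probability of one
  partition given \<open>Ks\<close>, and for the evidence of this partition.\<close>

definition evidence_bound :: "real \<Rightarrow> real" where
  "evidence_bound T = K_weight cK Ks / real n * (1 / real n ^ Ks) *
     exp (- real Ks * (ln (real n) / 2 + B\<^sup>2 + 2 + sqrt T + 1 / 2))"

lemma evidence_bound_pos: "0 < evidence_bound T"
  using n by (simp add: evidence_bound_def K_weight_def)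

lemma evidence_lower:
  assumes y: "y \<in> regular_noise n f0 T" and T: "0 \<le> T"
  shows "ennreal (evidence_bound T) \<le> (\<integral>\<^sup>+f. ennreal (lik_ratio n f0 f y) \<partial>pri)"
proof -
  let ?e = "exp (- real Ks * (ln (real n) / 2 + B\<^sup>2 + 2 + sqrt T + 1 / 2))"
  let ?I = "\<lambda>P. \<integral>\<^sup>+b. ennreal (lik_ratio n f0 (step_fun P b) y) \<partial>heights_prior Ks"
  have card: "0 < card (parts Ks)" using U0(2) finite_BI_K by (auto simp: card_gt_0_iff)
  have "1 / real n ^ Ks \<le> 1 / real (card (parts Ks))"
  proof (rule divide_left_mono)
    have "real (card (parts Ks)) \<le> real (n ^ Ks)" using card_BI_K_le[OF n] by (rule of_nat_mono)
    thus "real (card (parts Ks)) \<le> real n ^ Ks" by simp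
  qed (use card n in simp_all)
  hence "ennreal (1 / real n ^ Ks) * ennreal ?e \<le> ennreal (1 / real (card (parts Ks))) * ?I (cells U0)"
    using marginal_lower[OF y n T U0(1) f0 B] by (intro mult_mono ennreal_leI) simp_all
  also have "\<dots> \<le> avg Ks (\<lambda>f. ennreal (lik_ratio n f0 f y))"
    unfolding partition_average_def
    by (rule member_le_sum[where f = "\<lambda>P. ennreal (1 / real (card (parts Ks))) * ?I P"])
       (simp_all add: U0(2) finite_BI_K)
  finally have avg_ge: "ennreal (1 / real n ^ Ks) * ennreal ?e \<le> avg Ks (\<lambda>f. ennreal (lik_ratio n f0 f y))" .
  have "ennreal (evidence_bound T) =
      ennreal (K_weight cK Ks / real n) * (ennreal (1 / real n ^ Ks) * ennreal ?e)"
    unfolding evidence_bound_def by (simp add: ennreal_mult[symmetric] K_weight_def mult.assoc)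
  also have "\<dots> \<le> ennreal (K_pr Ks) * avg Ks (\<lambda>f. ennreal (lik_ratio n f0 f y))"
    by (intro mult_mono ennreal_leI K_prob_ge_weight avg_ge) simp_all
  also have "\<dots> \<le> (\<Sum>K\<in>adm. ennreal (K_pr K) * avg K (\<lambda>f. ennreal (lik_ratio n f0 f y)))"
    by (rule member_le_sum[where f = "\<lambda>K. ennreal (K_pr K) * avg K (\<lambda>f. ennreal (lik_ratio n f0 f y))"])
       (simp_all only: Ks_adm finite_adm zero_le)
  also have "\<dots> = (\<integral>\<^sup>+f. ennreal (lik_ratio n f0 f y) \<partial>pri)"
  proof (rule nn_integral_prior[symmetric])
    show "(\<lambda>f. ennreal (lik_ratio n f0 f y)) \<in> borel_measurable (step_space n Cmin Cmax)"
      by measurable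
  qed
  finally show ?thesis .
qed

definition far :: "real \<Rightarrow> (real \<Rightarrow> real) set" where
  "far \<rho> = {f \<in> step_class n Cmin Cmax. \<rho> \<le> emp_norm n (\<lambda>x. f x - f0 x)}"

lemma far_sets: "far \<rho> \<in> sets (step_space n Cmin Cmax)"
proof -
  note eval_measurable [measurable]
  have "far \<rho> = {f \<in> space (step_space n Cmin Cmax). \<rho> \<le> emp_norm n (\<lambda>x. f x - f0 x)}"
    by (simp add: far_def space_step_space)
  also have "\<dots> \<in> sets (step_space n Cmin Cmax)"
    unfolding emp_norm_def by measurable
  finally show ?thesis .
qed

lemma lik_ratio_far_le:
  assumes y: "y \<in> regular_noise n f0 T" and T: "0 \<le> T" and P: "P \<in> parts K"
    and \<rho>: "0 \<le> \<rho>" and far: "step_fun P b \<in> far \<rho>"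
  shows "lik_ratio n f0 (step_fun P b) y \<le> exp (T * (real K + real Ks) - real n * \<rho>\<^sup>2 / 4)"
proof -
  obtain U where U: "U \<subseteq> split_candidates n" "K = Suc (card U)" "P = cells U" using P by (rule BI_K_cells)
  have "lik_ratio n f0 (step_fun P b) y \<le>
    exp (T * real (Suc (card U) + Suc (card U0)) - real n * (emp_norm n (\<lambda>x. step_fun P b x - f0 x))\<^sup>2 / 4)"
    by (rule lik_ratio_upper[OF y n T U(1) U0(1)]) (simp_all only: U(3) f0)
  also have "\<dots> \<le> exp (T * (real K + real Ks) - real n * \<rho>\<^sup>2 / 4)"
  proof -
    have "\<rho>\<^sup>2 \<le> (emp_norm n (\<lambda>x. step_fun P b x - f0 x))\<^sup>2"
      using far \<rho> by (intro power_mono) (simp_all add: far_def)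
    hence "real n * \<rho>\<^sup>2 \<le> real n * (emp_norm n (\<lambda>x. step_fun P b x - f0 x))\<^sup>2"
      by (intro mult_left_mono) simp_all
    thus ?thesis by (simp add: U(2))
  qed
  finally show ?thesis .
qed

text \<open>The part of the evidence that comes from partitions with more than \<open>\<kappa>\<close> cells.\<close>

definition overfit :: "real \<Rightarrow> (nat \<Rightarrow> real) \<Rightarrow> ennreal" where
  "overfit \<kappa> y = (\<Sum>K | K \<in> adm \<and> \<kappa> < real K. ennreal (K_pr K) * avg K (\<lambda>f. ennreal (lik_ratio n f0 f y)))"

lemma overfit_measurable [measurable]: "overfit \<kappa> \<in> borel_measurable (data_law n f0)"
  unfolding overfit_def by measurable

text \<open>Two mechanisms: partitions with at most \<open>\<kappa>\<close> cells are handled by the distance to the truth, all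
  others by the number of their cells alone.\<close>

lemma numerator_upper:
  assumes y: "y \<in> regular_noise n f0 T" and T: "0 \<le> T" and \<rho>: "0 \<le> \<rho>"
  shows "(\<integral>\<^sup>+f. ennreal (lik_ratio n f0 f y) * indicator (far \<rho>) f \<partial>pri) \<le>
    ennreal (exp (T * (\<kappa> + real Ks) - real n * \<rho>\<^sup>2 / 4)) + overfit \<kappa> y"
proof -
  let ?e = "exp (T * (\<kappa> + real Ks) - real n * \<rho>\<^sup>2 / 4)"
  let ?g = "\<lambda>f. ennreal (lik_ratio n f0 f y)"
  let ?h = "\<lambda>f. ?g f * indicator (far \<rho>) f"
  let ?S = "{K. K \<in> adm \<and> \<not> \<kappa> < real K}" and ?L = "{K. K \<in> adm \<and> \<kappa> < real K}"
  have "far \<rho> \<in> sets (step_space n Cmin Cmax)" by (rule far_sets)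
  hence "?h \<in> borel_measurable (step_space n Cmin Cmax)" by measurable
  hence "(\<integral>\<^sup>+f. ?h f \<partial>pri) = (\<Sum>K\<in>adm. ennreal (K_pr K) * avg K ?h)" by (rule nn_integral_prior)
  also have "adm = ?S \<union> ?L" by blast
  also have "(\<Sum>K\<in>?S \<union> ?L. ennreal (K_pr K) * avg K ?h) =
      (\<Sum>K\<in>?S. ennreal (K_pr K) * avg K ?h) + (\<Sum>K\<in>?L. ennreal (K_pr K) * avg K ?h)"
    by (rule sum.union_disjoint) (use finite_adm in auto)
  also have "\<dots> \<le> ennreal ?e + overfit \<kappa> y"
  proof (rule add_mono)
    have "(\<Sum>K\<in>?S. ennreal (K_pr K) * avg K ?h) \<le> (\<Sum>K\<in>?S. ennreal (K_pr K) * ennreal ?e)"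
    proof (intro sum_mono mult_left_mono)
      fix K assume K: "K \<in> ?S"
      show "avg K ?h \<le> ennreal ?e"
      proof (rule avg_le)
        fix P assume P: "P \<in> parts K"
        show "(\<integral>\<^sup>+b. ?h (step_fun P b) \<partial>heights_prior K) \<le> ennreal ?e"
        proof (rule heights_integral_le)
          fix b
          show "?h (step_fun P b) \<le> ennreal ?e"
          proof (cases "step_fun P b \<in> far \<rho>")
            case True
            have "lik_ratio n f0 (step_fun P b) y \<le> exp (T * (real K + real Ks) - real n * \<rho>\<^sup>2 / 4)"
              by (rule lik_ratio_far_le[OF y T P \<rho> True])
            also have "\<dots> \<le> ?e" using K T by (simp add: mult_left_mono)
            finally show ?thesis using True by (simp add: ennreal_leI)
          qed simp
        qed
      qed (use K in simp)
    qed simp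
    also have "\<dots> = ennreal (\<Sum>K\<in>?S. K_pr K) * ennreal ?e"
      by (simp add: sum_distrib_right[symmetric] sum_ennreal K_prob_nonneg)
    also have "\<dots> \<le> 1 * ennreal ?e"
    proof (rule mult_right_mono)
      have "(\<Sum>K\<in>?S. K_pr K) \<le> (\<Sum>K\<in>adm. K_pr K)"
        by (rule sum_mono2) (use finite_adm K_prob_nonneg in auto)
      thus "ennreal (\<Sum>K\<in>?S. K_pr K) \<le> 1" using sum_K_prob by simp
    qed simp
    finally show "(\<Sum>K\<in>?S. ennreal (K_pr K) * avg K ?h) \<le> ennreal ?e" by simp
    show "(\<Sum>K\<in>?L. ennreal (K_pr K) * avg K ?h) \<le> overfit \<kappa> y"
      unfolding overfit_def
      by (intro sum_mono mult_left_mono avg_mono) (simp_all add: indicator_def)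
  qed
  finally show ?thesis .
qed

lemma expected_overfit:
  assumes T: "0 \<le> T" and v: "0 \<le> v"
    and v_bound: "\<And>K. K \<in> adm \<Longrightarrow> \<kappa> < real K \<Longrightarrow>
      K_weight cK K * sqrt (T * real K / (Cmin\<^sup>2 * real n)) ^ K \<le> v"
  shows "(\<integral>\<^sup>+y. indicator (regular_noise n f0 T) y * overfit \<kappa> y \<partial>data_law n f0) \<le> ennreal (real n * v)"
proof -
  let ?M = "data_law n f0" and ?L = "{K. K \<in> adm \<and> \<kappa> < real K}"
  let ?A = "\<lambda>K y. indicator (regular_noise n f0 T) y * avg K (\<lambda>f. ennreal (lik_ratio n f0 f y))"
  have meas: "?A K \<in> borel_measurable ?M" for K by measurable
  have "(\<integral>\<^sup>+y. indicator (regular_noise n f0 T) y * overfit \<kappa> y \<partial>?M) =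
    (\<integral>\<^sup>+y. (\<Sum>K\<in>?L. ennreal (K_pr K) * ?A K y) \<partial>?M)"
    unfolding overfit_def by (intro nn_integral_cong) (simp add: sum_distrib_left mult_ac)
  also have "\<dots> = (\<Sum>K\<in>?L. \<integral>\<^sup>+y. ennreal (K_pr K) * ?A K y \<partial>?M)"
    by (rule nn_integral_sum) (intro borel_measurable_times_ennreal borel_measurable_const meas)
  also have "\<dots> = (\<Sum>K\<in>?L. ennreal (K_pr K) * (\<integral>\<^sup>+y. ?A K y \<partial>?M))"
    by (intro sum.cong refl nn_integral_cmult meas)
  also have "\<dots> \<le> (\<Sum>K\<in>?L. ennreal v)"
  proof (rule sum_mono)
    fix K assume K: "K \<in> ?L"
    let ?q = "sqrt (T * real K / (Cmin\<^sup>2 * real n)) ^ K"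
    have q: "0 \<le> ?q" using T by (intro zero_le_power real_sqrt_ge_zero) simp
    have "ennreal (K_pr K) * (\<integral>\<^sup>+y. ?A K y \<partial>?M) \<le> ennreal (K_weight cK K) * ennreal ?q"
      using K by (intro mult_mono ennreal_leI K_prob_le_weight expected_avg_on_regular_noise T) simp_all
    also have "\<dots> = ennreal (K_weight cK K * ?q)"
      using q by (simp add: ennreal_mult K_weight_def)
    also have "\<dots> \<le> ennreal v" using K by (intro ennreal_leI v_bound) simp_all
    finally show "ennreal (K_pr K) * (\<integral>\<^sup>+y. ?A K y \<partial>?M) \<le> ennreal v" .
  qed
  also have "\<dots> = ennreal (real (card ?L) * v)"
    using v by (simp add: ennreal_mult ennreal_of_nat_eq_real_of_nat)
  also have "\<dots> \<le> ennreal (real n * v)"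
  proof (intro ennreal_leI mult_right_mono v of_nat_mono)
    have "card ?L \<le> card {1..n}"
    proof (rule card_mono)
      show "?L \<subseteq> {1..n}"
      proof
        fix K assume "K \<in> ?L"
        hence K: "K \<in> adm" by simp
        show "K \<in> {1..n}" using admD(1)[OF K] admissible_K_le[OF n K] by simp
      qed
    qed simp
    thus "card ?L \<le> n" by simp
  qed
  finally show ?thesis .
qed

text \<open>Off the regular event nothing is claimed, which costs its probability. On it, the few-cell part
  of the numerator is deterministically below half of the threshold, and the overfitting part is
  controlled by Markov's inequality through its expectation.\<close>

lemma posterior_far_probability:
  assumes T: "0 \<le> T" and v: "0 \<le> v" and \<rho>: "0 \<le> \<rho>" and \<epsilon>: "0 < \<epsilon>"
    and v_bound: "\<And>K. K \<in> adm \<Longrightarrow> \<kappa> < real K \<Longrightarrow>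
      K_weight cK K * sqrt (T * real K / (Cmin\<^sup>2 * real n)) ^ K \<le> v"
    and small: "exp (T * (\<kappa> + real Ks) - real n * \<rho>\<^sup>2 / 4) \<le> \<epsilon> / 2 * evidence_bound T"
  shows "measure (data_law n f0) {y \<in> space (data_law n f0). \<epsilon> < measure (post y) (far \<rho>)}
    \<le> 2 * (real n + 1)\<^sup>2 * exp (- T / 2) + 2 * real n * v / (\<epsilon> * evidence_bound T)"
proof -
  let ?M = "data_law n f0" and ?R = "regular_noise n f0 T" and ?d = "evidence_bound T"
  interpret prob_space ?M by (rule prob_space_data_law)
  note d = evidence_bound_pos[of T]
  let ?c = "ennreal (2 / (\<epsilon> * ?d))"
  let ?u = "\<lambda>y. indicator ?R y * overfit \<kappa> y"
  define H where "H = {y \<in> space ?M. 1 \<le> ?c * ?u y}"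
  have H_sets: "H \<in> sets ?M" unfolding H_def by measurable
  have cover: "y \<in> H" if y: "y \<in> ?R" and large: "\<epsilon> < measure (post y) (far \<rho>)" for y
  proof (rule ccontr)
    assume "y \<notin> H"
    hence lt: "?c * overfit \<kappa> y < 1" using y by (simp add: H_def regular_noise_def not_le)
    have c_pos: "0 < 2 / (\<epsilon> * ?d)" using d \<epsilon> by simp
    have "overfit \<kappa> y \<noteq> \<top>"
      using lt c_pos d \<epsilon> by (auto simp: ennreal_mult_top split: if_splits)
    then obtain q where q: "overfit \<kappa> y = ennreal q" "0 \<le> q" by (cases "overfit \<kappa> y") auto
    have "2 / (\<epsilon> * ?d) * q < 1"
      using lt c_pos q(2) unfolding q(1) by (simp add: ennreal_mult[symmetric] ennreal_less_one_iff)
    hence q_lt: "q < \<epsilon> / 2 * ?d" using d \<epsilon> by (simp add: field_simps)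
    let ?e = "exp (T * (\<kappa> + real Ks) - real n * \<rho>\<^sup>2 / 4)"
    have "(\<integral>\<^sup>+f. ennreal (lik_ratio n f0 f y) * indicator (far \<rho>) f \<partial>pri) \<le> ennreal ?e + ennreal q"
      using numerator_upper[OF y T \<rho>, of \<kappa>] unfolding q(1) .
    also have "\<dots> = ennreal (?e + q)" using q(2) by (simp add: ennreal_plus)
    finally have "measure (post y) (far \<rho>) \<le> (?e + q) / ?d"
      using q(2) by (intro posterior_measure_le[OF far_sets d _ evidence_lower[OF y T]]) simp_all
    also have "\<dots> < \<epsilon>" using small q_lt d by (simp add: field_simps)
    finally show False using large by simp
  qed
  have "{y \<in> space ?M. \<epsilon> < measure (post y) (far \<rho>)} \<subseteq> (space ?M - ?R) \<union> H"
    using cover by blast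
  hence "measure ?M {y \<in> space ?M. \<epsilon> < measure (post y) (far \<rho>)} \<le> measure ?M ((space ?M - ?R) \<union> H)"
    by (rule finite_measure_mono) (use H_sets regular_noise_sets in auto)
  also have "\<dots> \<le> measure ?M (space ?M - ?R) + measure ?M H"
    by (rule measure_Un_le) (use H_sets regular_noise_sets in auto)
  also have "\<dots> \<le> 2 * (real n + 1)\<^sup>2 * exp (- T / 2) + 2 * real n * v / (\<epsilon> * ?d)"
  proof (rule add_mono)
    show "measure ?M (space ?M - ?R) \<le> 2 * (real n + 1)\<^sup>2 * exp (- T / 2)"
      by (rule measure_not_regular_noise[OF T])
    have u_meas: "(\<lambda>y. ?u y * indicator (space ?M) y) \<in> borel_measurable ?M" by measurable
    have "emeasure ?M H \<le> ?c * (\<integral>\<^sup>+y. ?u y * indicator (space ?M) y \<partial>?M)"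
      unfolding H_def by (rule nn_integral_Markov_inequality[OF u_meas]) simp
    also have "(\<integral>\<^sup>+y. ?u y * indicator (space ?M) y \<partial>?M) = (\<integral>\<^sup>+y. ?u y \<partial>?M)"
      by (intro nn_integral_cong) simp
    also have "?c * (\<integral>\<^sup>+y. ?u y \<partial>?M) \<le> ?c * ennreal (real n * v)"
      by (intro mult_left_mono expected_overfit T v v_bound) simp_all
    also have "\<dots> = ennreal (2 * real n * v / (\<epsilon> * ?d))"
      using v d \<epsilon> by (subst ennreal_mult[symmetric]) (simp_all add: mult_ac)
    finally show "measure ?M H \<le> 2 * real n * v / (\<epsilon> * ?d)"
      using v d \<epsilon> by (simp add: emeasure_eq_measure)
  qed
  finally show ?thesis .
qed

end

section \<open>Contraction rate\<close>

text \<open>Two penalties cooperate. The prior gives \<open>exp (- cK * K * ln K)\<close>, which is weak for small \<open>K\<close>;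
  the marginal likelihood gives \<open>(K / n) powr (K / 2)\<close> up to logarithms, which is weak for \<open>K\<close> close
  to \<open>n\<close>. Divided by \<open>K\<close>, their exponents are linear in \<open>ln K\<close>, so that checking \<open>ln K = 0\<close> and \<open>ln K = ln n\<close> shows
  that together they are of order \<open>exp (- c * K * ln n)\<close> for every \<open>K\<close> from \<open>1\<close> to \<open>n\<close>.\<close>

lemma overfit_penalty:
  fixes cK Cmin L :: real
  assumes cK: "0 < cK" and Cmin: "0 < Cmin" and n: "1 \<le> n" and K: "1 \<le> K" "K \<le> n"
    and L: "L = ln (real n)" "1 \<le> L"
    and large: "ln (6 * L) - 2 * ln Cmin \<le> min cK (1 / 2) * L"
  shows "K_weight cK K * sqrt (6 * L * real K / (Cmin\<^sup>2 * real n)) ^ K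
    \<le> exp (- (min cK (1 / 2) / 2) * (real K * L))"
proof -
  define l where "l = ln (real K)"
  have l: "0 \<le> l" "l \<le> L" using K n by (simp_all add: l_def L(1))
  define c where "c = min cK (1 / 2)"
  have q_pos: "0 < 6 * L * real K / (Cmin\<^sup>2 * real n)" using L(2) K n Cmin by simp
  have ln_q: "ln (6 * L * real K / (Cmin\<^sup>2 * real n)) = ln (6 * L) + l - 2 * ln Cmin - L"
  proof -
    have pos: "0 < 6 * L" "0 < real K" "0 < Cmin\<^sup>2" "0 < real n" using L(2) K n Cmin by simp_all
    have "ln (6 * L * real K / (Cmin\<^sup>2 * real n)) = ln (6 * L * real K) - ln (Cmin\<^sup>2 * real n)"
      by (rule ln_divide_pos[OF mult_pos_pos[OF pos(1,2)] mult_pos_pos[OF pos(3,4)]])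
    also have "ln (6 * L * real K) = ln (6 * L) + l" unfolding l_def by (rule ln_mult_pos[OF pos(1,2)])
    also have "ln (Cmin\<^sup>2 * real n) = ln (Cmin\<^sup>2) + L" unfolding L(1) by (rule ln_mult_pos[OF pos(3,4)])
    also have "ln (Cmin\<^sup>2) = 2 * ln Cmin" using ln_realpow[of Cmin 2] by simp
    finally show ?thesis by simp
  qed
  have "sqrt (6 * L * real K / (Cmin\<^sup>2 * real n)) = exp (ln (6 * L * real K / (Cmin\<^sup>2 * real n)) / 2)"
    using q_pos by (simp add: ln_sqrt[symmetric])
  hence "sqrt (6 * L * real K / (Cmin\<^sup>2 * real n)) ^ K =
      exp (real K * ((ln (6 * L) + l - 2 * ln Cmin - L) / 2))"
    unfolding ln_q by (simp only: exp_of_nat_mult[symmetric])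
  hence "K_weight cK K * sqrt (6 * L * real K / (Cmin\<^sup>2 * real n)) ^ K =
      exp (real K * (- cK * l + (ln (6 * L) + l - 2 * ln Cmin - L) / 2))"
    unfolding K_weight_def l_def[symmetric] by (simp add: exp_add[symmetric] algebra_simps)
  also have "\<dots> \<le> exp (real K * (- (c / 2) * L))"
  proof (intro iffD2[OF exp_le_cancel_iff] mult_left_mono)
    have "- cK * l + l / 2 - L / 2 \<le> - c * L"
    proof (cases "cK \<le> 1 / 2")
      case True
      have "(1 / 2 - cK) * l \<le> (1 / 2 - cK) * L" using True l by (intro mult_left_mono) auto
      thus ?thesis using True by (simp add: c_def min_def algebra_simps)
    next
      case False
      have "0 \<le> (cK - 1 / 2) * l" using False l by (intro mult_nonneg_nonneg) auto
      thus ?thesis using False by (simp add: c_def min_def algebra_simps)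
    qed
    thus "- cK * l + (ln (6 * L) + l - 2 * ln Cmin - L) / 2 \<le> - (c / 2) * L"
    proof -
      have "ln (6 * L) - 2 * ln Cmin \<le> c * L" using large by (simp only: c_def)
      moreover have "a + (u + l - w - L) / 2 \<le> - x / 2"
        if "u - w \<le> x" "a + l / 2 - L / 2 \<le> - x" for a u w x :: real
        using that by (simp add: field_simps)
      ultimately have "- cK * l + (ln (6 * L) + l - 2 * ln Cmin - L) / 2 \<le> - (c * L) / 2"
        using \<open>- cK * l + l / 2 - L / 2 \<le> - c * L\<close> by (simp only: mult_minus_left)
      thus ?thesis by simp
    qed
  qed simp
  finally show ?thesis by (simp add: c_def mult_ac)
qed

context balanced_truth
begin

text \<open>Each contribution to the negative logarithm of the evidence bound is at most a multiple of
  \<open>Ks * ln n\<close> or of \<open>Ks * B\<^sup>2\<close>. This is where the bound on the true step heights and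
  \<open>2 * \<beta> \<ge> 1\<close> enter, the latter in the form \<open>L \<le> \<Lambda>\<close>.\<close>

lemma evidence_bound_ge:
  assumes L: "L = ln (real n)" "1 \<le> L" "L \<le> \<Lambda>" and B: "B\<^sup>2 \<le> C * \<Lambda>" and C: "0 \<le> C"
  shows "exp (- (cK + C + 12) * (real Ks * \<Lambda>)) \<le> evidence_bound (6 * L)"
proof -
  have \<Lambda>: "1 \<le> \<Lambda>" using L by simp
  have Ks: "1 \<le> real Ks" by simp
  have Ks_n: "real Ks \<le> real n" using admissible_K_le[OF n Ks_adm] by simp
  have lnK: "0 \<le> ln (real Ks)" "ln (real Ks) \<le> L"
    using Ks_n Ks n unfolding L(1) by (simp_all only: ln_ge_zero ln_mono)
  have sq: "sqrt (6 * L) \<le> 6 * L"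
  proof (rule real_le_lsqrt)
    have "6 * L * 1 \<le> 6 * L * (6 * L)" using L(2) by (intro mult_left_mono) auto
    thus "6 * L \<le> (6 * L)\<^sup>2" by (simp add: power2_eq_square)
  qed (use L in auto)
  have "evidence_bound (6 * L) = exp (- cK * real Ks * ln (real Ks)) * exp (- L) * exp (- real Ks * L) *
      exp (- real Ks * (L / 2 + B\<^sup>2 + 2 + sqrt (6 * L) + 1 / 2))"
  proof -
    have nL: "exp (- L) = 1 / real n" using n by (simp add: L(1) exp_minus inverse_eq_divide)
    have "exp (- real Ks * L) = exp (- L) ^ Ks" by (simp only: exp_of_nat_mult[symmetric] mult_minus_left mult_minus_right)
    hence "exp (- real Ks * L) = 1 / real n ^ Ks" by (simp only: nL power_one_over)
    thus ?thesis unfolding evidence_bound_def K_weight_def nL L(1)[symmetric] by simp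
  qed
  also have "\<dots> = exp (- (cK * real Ks * ln (real Ks) + L + real Ks * L +
      real Ks * (L / 2 + B\<^sup>2 + 2 + sqrt (6 * L) + 1 / 2)))"
    by (simp only: exp_add[symmetric]) (simp only: minus_add_distrib mult_minus_left add.assoc)
  also have "\<dots> \<ge> exp (- ((cK + C + 12) * (real Ks * \<Lambda>)))"
  proof (intro iffD2[OF exp_le_cancel_iff] iffD2[OF neg_le_iff_le])
    have 1: "cK * real Ks * ln (real Ks) \<le> cK * real Ks * \<Lambda>"
      using cK lnK L by (intro mult_left_mono) auto
    have 2: "L \<le> real Ks * \<Lambda>" using L(3) Ks \<Lambda> mult_right_mono[of 1 "real Ks" \<Lambda>] by linarith
    have 3: "real Ks * L \<le> real Ks * \<Lambda>" using L(3) by (intro mult_left_mono) auto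
    have "L / 2 + B\<^sup>2 + 2 + sqrt (6 * L) + 1 / 2 \<le> (10 + C) * \<Lambda>"
      using sq L B \<Lambda> by (simp add: algebra_simps)
    hence 4: "real Ks * (L / 2 + B\<^sup>2 + 2 + sqrt (6 * L) + 1 / 2) \<le> real Ks * ((10 + C) * \<Lambda>)"
      by (intro mult_left_mono) auto
    have "(cK + C + 12) * (real Ks * \<Lambda>) =
        cK * real Ks * \<Lambda> + real Ks * \<Lambda> + real Ks * \<Lambda> + real Ks * ((10 + C) * \<Lambda>)"
      by (simp add: algebra_simps)
    thus "cK * real Ks * ln (real Ks) + L + real Ks * L +
      real Ks * (L / 2 + B\<^sup>2 + 2 + sqrt (6 * L) + 1 / 2) \<le> (cK + C + 12) * (real Ks * \<Lambda>)"
      using 1 2 3 4 by linarith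
  qed
  finally show ?thesis by (simp only: mult_minus_left)
qed

text \<open>Here \<open>\<Lambda>\<close> stands for \<open>(ln n) powr (2 * \<beta>)\<close>, and \<open>G = Ks * \<Lambda>\<close> is, up to constants,
  the squared rate times \<open>n\<close>. The
  evidence is at least \<open>exp (- C1 * G)\<close>. The number of cells \<open>\<kappa>\<close> is chosen proportional to
  \<open>G / ln n\<close>, with a factor that brings the expected overfitting part down to \<open>exp (- (C1 + 2) * G)\<close>;
  since \<open>T * \<kappa>\<close> is then still of order \<open>G\<close>, a radius with \<open>n * \<rho>\<^sup>2\<close> at least a large multiple of \<open>G\<close>
  makes the remaining part small.\<close>

lemma contraction_bound:
  fixes L \<Lambda> C \<epsilon> \<rho> :: real
  defines "c \<equiv> min cK (1 / 2)" and "C1 \<equiv> cK + C + 12"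
  assumes L: "L = ln (real n)" "1 \<le> L" "L \<le> \<Lambda>" and B_le: "B\<^sup>2 \<le> C * \<Lambda>" and C: "0 \<le> C"
    and large: "ln (6 * L) - 2 * ln Cmin \<le> c * L"
    and \<epsilon>: "0 < \<epsilon>" and \<rho>: "0 \<le> \<rho>"
    and \<rho>_ge: "4 * (12 * (C1 + 2) / c + 6 + C1 + \<bar>ln (\<epsilon> / 2)\<bar>) * (real Ks * \<Lambda>) \<le> real n * \<rho>\<^sup>2"
  shows "measure (data_law n f0) {y \<in> space (data_law n f0). \<epsilon> < measure (post y) (far \<rho>)}
    \<le> (8 + 2 / \<epsilon>) / real n"
proof -
  define G where "G = real Ks * \<Lambda>"
  define \<kappa> where "\<kappa> = 2 * (C1 + 2) / c * G / L"
  define v where "v = exp (- (C1 + 2) * G)"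
  have \<Lambda>: "1 \<le> \<Lambda>" using L by simp
  have c: "0 < c" using cK by (simp add: c_def)
  have C1: "0 < C1" using cK C by (simp add: C1_def)
  have "1 * \<Lambda> \<le> real Ks * \<Lambda>" using \<Lambda> by (intro mult_right_mono) auto
  hence "\<Lambda> \<le> G" by (simp only: G_def mult_1)
  hence G: "\<Lambda> \<le> G" "L \<le> G" "1 \<le> G" using L \<Lambda> by linarith+
  have ev: "exp (- C1 * G) \<le> evidence_bound (6 * L)"
    unfolding C1_def G_def by (rule evidence_bound_ge[OF L B_le C])
  have "measure (data_law n f0) {y \<in> space (data_law n f0). \<epsilon> < measure (post y) (far \<rho>)}
    \<le> 2 * (real n + 1)\<^sup>2 * exp (- (6 * L) / 2) + 2 * real n * v / (\<epsilon> * evidence_bound (6 * L))"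
  proof (rule posterior_far_probability[where \<kappa> = \<kappa>])
    show "0 \<le> 6 * L" "0 \<le> v" "0 \<le> \<rho>" "0 < \<epsilon>" using L(2) \<rho> \<epsilon> by (simp_all add: v_def)
  next
    fix K assume K: "K \<in> adm" "\<kappa> < real K"
    have "K_weight cK K * sqrt (6 * L * real K / (Cmin\<^sup>2 * real n)) ^ K \<le> exp (- (c / 2) * (real K * L))"
      unfolding c_def
      by (rule overfit_penalty[OF cK Cmin(1) n admD(1)[OF K(1)] admissible_K_le[OF n K(1)] L(1,2)])
         (use large in \<open>simp add: c_def\<close>)
    also have "\<dots> \<le> v"
    proof -
      have "\<kappa> * L \<le> real K * L" using K(2) L(2) by (intro mult_right_mono) auto
      hence "c / 2 * (\<kappa> * L) \<le> c / 2 * (real K * L)" using c by (intro mult_left_mono) auto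
      moreover have "c / 2 * (\<kappa> * L) = (C1 + 2) * G" using c L(2) by (simp add: \<kappa>_def field_simps)
      ultimately have "(C1 + 2) * G \<le> c / 2 * (real K * L)" by linarith
      thus ?thesis by (simp only: v_def exp_le_cancel_iff mult_minus_left neg_le_iff_le)
    qed
    finally show "K_weight cK K * sqrt (6 * L * real K / (Cmin\<^sup>2 * real n)) ^ K \<le> v" .
  next
    define Z where "Z = 12 * (C1 + 2) / c + 6 + C1 + \<bar>ln (\<epsilon> / 2)\<bar>"
    have "6 * L * \<kappa> = 12 * (C1 + 2) / c * G" using L(2) c by (simp add: \<kappa>_def field_simps)
    moreover have "6 * L * real Ks \<le> 6 * G" using L(3) by (simp add: G_def mult_left_mono mult.commute)
    moreover have "4 * Z * G \<le> real n * \<rho>\<^sup>2" unfolding Z_def G_def by (rule \<rho>_ge)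
    moreover have "Z * G = 12 * (C1 + 2) / c * G + 6 * G + C1 * G + \<bar>ln (\<epsilon> / 2)\<bar> * G"
      by (simp only: Z_def distrib_right)
    moreover have "6 * L * (\<kappa> + real Ks) = 6 * L * \<kappa> + 6 * L * real Ks" by (rule distrib_left)
    moreover have "\<bar>ln (\<epsilon> / 2)\<bar> * 1 \<le> \<bar>ln (\<epsilon> / 2)\<bar> * G" using G by (intro mult_left_mono) auto
    ultimately have "6 * L * (\<kappa> + real Ks) - real n * \<rho>\<^sup>2 / 4 \<le> ln (\<epsilon> / 2) + (- C1 * G)"
      by linarith
    hence "exp (6 * L * (\<kappa> + real Ks) - real n * \<rho>\<^sup>2 / 4) \<le> exp (ln (\<epsilon> / 2) + (- C1 * G))"
      by (rule iffD2[OF exp_le_cancel_iff])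
    also have "\<dots> = \<epsilon> / 2 * exp (- C1 * G)" using \<epsilon> by (simp only: exp_add) simp
    also have "\<dots> \<le> \<epsilon> / 2 * evidence_bound (6 * L)" using ev \<epsilon> by (intro mult_left_mono) auto
    finally show "exp (6 * L * (\<kappa> + real Ks) - real n * \<rho>\<^sup>2 / 4) \<le> \<epsilon> / 2 * evidence_bound (6 * L)" .
  qed
  also have "\<dots> \<le> 8 / real n + 2 / \<epsilon> / real n"
  proof (rule add_mono)
    have "exp (- (6 * L) / 2) = exp (- L) ^ 3" by (simp add: exp_of_nat_mult[symmetric])
    also have "exp (- L) = 1 / real n" using n by (simp add: L(1) exp_minus inverse_eq_divide)
    finally have e: "exp (- (6 * L) / 2) = 1 / real n ^ 3" by (simp add: power_one_over)
    have "(real n + 1)\<^sup>2 \<le> (2 * real n)\<^sup>2" using n by (intro power_mono) auto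
    hence "2 * (real n + 1)\<^sup>2 * (1 / real n ^ 3) \<le> 2 * (2 * real n)\<^sup>2 * (1 / real n ^ 3)"
      by (intro mult_right_mono mult_left_mono) auto
    also have "\<dots> = 8 / real n" using n by (simp add: power2_eq_square power3_eq_cube field_simps)
    finally show "2 * (real n + 1)\<^sup>2 * exp (- (6 * L) / 2) \<le> 8 / real n" unfolding e .
    have "2 * real n * v / (\<epsilon> * evidence_bound (6 * L)) \<le> 2 * real n * v / (\<epsilon> * exp (- C1 * G))"
      using ev \<epsilon> evidence_bound_pos[of "6 * L"]
      by (intro divide_left_mono mult_left_mono mult_pos_pos) (auto simp: v_def)
    also have "\<dots> = 2 * real n / \<epsilon> * (v / exp (- C1 * G))" by simp
    also have "v / exp (- C1 * G) = exp (- 2 * G)"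
      unfolding v_def exp_diff[symmetric] by (simp add: algebra_simps)
    also have "2 * real n / \<epsilon> * exp (- 2 * G) \<le> 2 * real n / \<epsilon> * exp (- 2 * L)"
      using G(2) \<epsilon> by (intro mult_left_mono) auto
    also have "exp (- 2 * L) = 1 / (real n)\<^sup>2"
    proof -
      have "exp (- 2 * L) = exp (- L) ^ 2" by (simp add: exp_of_nat_mult[symmetric])
      also have "exp (- L) = 1 / real n" using n by (simp add: L(1) exp_minus inverse_eq_divide)
      finally show ?thesis by (simp add: power_one_over)
    qed
    also have "2 * real n / \<epsilon> * (1 / (real n)\<^sup>2) = 2 / \<epsilon> / real n"
      using n by (simp add: power2_eq_square)
    finally show "2 * real n * v / (\<epsilon> * evidence_bound (6 * L)) \<le> 2 / \<epsilon> / real n" .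
  qed
  also have "\<dots> = (8 + 2 / \<epsilon>) / real n" by (simp add: add_divide_distrib)
  finally show ?thesis .
qed

end

text \<open>For complexities of order \<open>sqrt n\<close> the logarithms of \<open>n / K\<close> and of \<open>n\<close> are comparable.\<close>

lemma ln_ratio_ge:
  assumes "0 < K" "K \<le> C * sqrt x" "C * sqrt x \<le> x powr (3 / 4)" "1 \<le> x"
  shows "ln x / 4 \<le> ln (x / K)"
proof -
  have "K \<le> x powr (3 / 4)" using assms by linarith
  hence "ln K \<le> ln (x powr (3 / 4))" using assms(1) by (intro ln_mono)
  also have "\<dots> = 3 / 4 * ln x" using assms by (simp add: ln_powr)
  finally show ?thesis using assms by (simp add: ln_div)
qed

theorem theorem3p2:
  fixes Cmin Cmax cK \<beta> :: real
    and f0 :: "nat \<Rightarrow> real \<Rightarrow> real"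
    and K0 :: "nat \<Rightarrow> nat"
    and P0 :: "nat \<Rightarrow> real set list"
    and b0 :: "nat \<Rightarrow> nat \<Rightarrow> real"
    and Kf0 :: "nat \<Rightarrow> nat"
    and M :: "nat \<Rightarrow> real"
  assumes "0 < Cmin" and "Cmin \<le> 1" and "1 \<le> Cmax"
    and "0 < cK"
    and "1 / 2 < \<beta>"
    and "\<And>n. 1 \<le> n \<Longrightarrow> length (P0 n) = K0 n"
    and "\<And>n. 1 \<le> n \<Longrightarrow> minimal_representation (P0 n) (b0 n) (f0 n)"
    and "\<And>n. 1 \<le> n \<Longrightarrow> supported_on_class (BI n Cmin Cmax) (f0 n)"
    and "\<And>n. 1 \<le> n \<Longrightarrow> Kf0 n = complexity (P0 n) (BI n Cmin Cmax)"
    and "(\<lambda>n. (sup_norm (K0 n) (b0 n))\<^sup>2) \<in> O(\<lambda>n. ln (real n) powr (2 * \<beta>))"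
    and "(\<lambda>n. real (Kf0 n)) \<in> O(\<lambda>n. sqrt (real n))"
    and "filterlim M at_top sequentially"
  shows "\<forall>\<epsilon>>0. (\<lambda>n. measure (data_law n (f0 n))
            {y \<in> space (data_law n (f0 n)).
               measure (posterior n Cmin Cmax cK y)
                 {f \<in> step_class n Cmin Cmax.
                    emp_norm n (\<lambda>x. f x - f0 n x) \<ge>
                      M n * (1 / sqrt (real n)) *
                      sqrt (real (Kf0 n) * ln (real n / real (Kf0 n)) powr (2 * \<beta>))} > \<epsilon>})
          \<longlonglongrightarrow> 0"
proof (intro allI impI)
  fix \<epsilon> :: real assume \<epsilon>: "0 < \<epsilon>"
  let ?r = "\<lambda>n. M n * (1 / sqrt (real n)) *
    sqrt (real (Kf0 n) * ln (real n / real (Kf0 n)) powr (2 * \<beta>))"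
  let ?p = "\<lambda>n. measure (data_law n (f0 n)) {y \<in> space (data_law n (f0 n)).
    measure (posterior n Cmin Cmax cK y)
      {f \<in> step_class n Cmin Cmax. emp_norm n (\<lambda>x. f x - f0 n x) \<ge> ?r n} > \<epsilon>}"
  obtain C where C: "0 < C" "\<forall>\<^sub>F n in sequentially.
      norm ((sup_norm (K0 n) (b0 n))\<^sup>2) \<le> C * norm (ln (real n) powr (2 * \<beta>))"
    using landau_o.bigE[OF assms(10)] by blast
  obtain D where D: "0 < D" "\<forall>\<^sub>F n in sequentially. norm (real (Kf0 n)) \<le> D * norm (sqrt (real n))"
    using landau_o.bigE[OF assms(11)] by blast
  define c where "c = min cK (1 / 2)"
  define C1 where "C1 = cK + C + 12"
  define Z where "Z = 4 * (12 * (C1 + 2) / c + 6 + C1 + \<bar>ln (\<epsilon> / 2)\<bar>)"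
  define s :: real where "s = (1 / 4) powr (2 * \<beta>)"
  have c: "0 < c" using assms(4) by (simp add: c_def)
  have s: "0 < s" by (simp add: s_def)
  have ev_powr: "\<forall>\<^sub>F n in sequentially. D * sqrt (real n) \<le> real n powr (3 / 4)"
    using D(1) by real_asymp
  have ev_L: "\<forall>\<^sub>F n in sequentially. 1 \<le> ln (real n)" by real_asymp
  have ev_pen: "\<forall>\<^sub>F n in sequentially. ln (6 * ln (real n)) - 2 * ln Cmin \<le> c * ln (real n)"
    using c by real_asymp
  have ev_M: "\<forall>\<^sub>F n in sequentially. max 1 (Z / s) \<le> M n"
    using assms(12) unfolding filterlim_at_top by blast
  have "\<forall>\<^sub>F n in sequentially. ?p n \<le> (8 + 2 / \<epsilon>) / real n"
    using C(2) D(2) ev_powr ev_L ev_pen ev_M eventually_ge_at_top[of 1]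
  proof eventually_elim
    case (elim n)
    have n: "1 \<le> n" using elim by simp
    define L where "L = ln (real n)"
    define \<Lambda> where "\<Lambda> = L powr (2 * \<beta>)"
    have L: "1 \<le> L" using elim by (simp add: L_def)
    \<comment> \<open>the cost \<open>Ks * ln n\<close> of choosing a partition has to be dominated by \<open>Ks * \<Lambda>\<close>, which is what the lower bound on \<open>\<beta>\<close> is for\<close>
    have "L powr 1 \<le> L powr (2 * \<beta>)" using L assms(5) by (intro powr_mono) auto
    hence L\<Lambda>: "L \<le> \<Lambda>" using L by (simp add: \<Lambda>_def)
    obtain U b where U: "U \<subseteq> split_candidates n"
      "Suc (card U) = complexity (P0 n) (BI n Cmin Cmax)"
      "cells U \<in> BI_K n Cmin Cmax (Suc (card U))"
      "\<And>x. x \<in> {0<..1} \<Longrightarrow> f0 n x = step_fun (cells U) b x"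
      "\<And>k. k \<le> card U \<Longrightarrow> \<bar>b k\<bar> \<le> sup_norm (length (P0 n)) (b0 n)"
      by (rule complexity_attained[OF assms(7,8)[OF n]]) (rule that)
    interpret balanced_truth n Cmin Cmax cK "f0 n" U b "sup_norm (K0 n) (b0 n)"
      using n assms(1-4) U assms(6)[OF n] by unfold_locales simp_all
    have Kf0: "Kf0 n = Ks" using U(2) assms(9)[OF n] by simp
    have "ln (real n) / 4 \<le> ln (real n / real (Kf0 n))"
      by (rule ln_ratio_ge[of _ D]) (use elim n Kf0 in simp_all)
    hence "(L / 4) powr (2 * \<beta>) \<le> ln (real n / real (Kf0 n)) powr (2 * \<beta>)"
      using L assms(5) by (intro powr_mono2) (simp_all add: L_def)
    moreover have "(L / 4) powr (2 * \<beta>) = s * \<Lambda>"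
      using L powr_mult[of "1 / 4" L "2 * \<beta>"] by (simp add: s_def \<Lambda>_def)
    ultimately have lnKs: "s * \<Lambda> \<le> ln (real n / real (Kf0 n)) powr (2 * \<beta>)" by simp
    \<comment> \<open>divergence of \<open>M\<close> beats the fixed constant \<open>Z\<close>, and \<open>M n \<ge> 1\<close> gives \<open>M n \<le> (M n)\<^sup>2\<close>\<close>
    have M: "1 \<le> M n" "Z \<le> s * M n" using elim s by (simp_all add: field_simps)
    have "real n * (?r n)\<^sup>2 = (M n)\<^sup>2 * (real (Kf0 n) * ln (real n / real (Kf0 n)) powr (2 * \<beta>))"
      using n by (simp add: power_mult_distrib power_divide)
    also have "\<dots> \<ge> M n * (real (Kf0 n) * (s * \<Lambda>))"
    proof (intro mult_mono mult_left_mono lnKs)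
      show "M n \<le> (M n)\<^sup>2" using M(1) mult_left_mono[of 1 "M n" "M n"] by (simp add: power2_eq_square)
    qed (use s L L\<Lambda> in simp_all)
    finally have "s * M n * (real Ks * \<Lambda>) \<le> real n * (?r n)\<^sup>2" unfolding Kf0 by (simp add: mult_ac)
    moreover have "Z * (real Ks * \<Lambda>) \<le> s * M n * (real Ks * \<Lambda>)"
      using M(2) L L\<Lambda> by (intro mult_right_mono) simp_all
    ultimately have \<rho>_ge: "Z * (real Ks * \<Lambda>) \<le> real n * (?r n)\<^sup>2" by linarith
    have "?p n = measure (data_law n (f0 n)) {y \<in> space (data_law n (f0 n)). \<epsilon> < measure (post y) (far (?r n))}"
      unfolding far_def ..
    also have "\<dots> \<le> (8 + 2 / \<epsilon>) / real n"
    proof (rule contraction_bound[where C = C and \<Lambda> = \<Lambda>, OF L_def L L\<Lambda>])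
      show "(sup_norm (K0 n) (b0 n))\<^sup>2 \<le> C * \<Lambda>" using elim L by (simp add: \<Lambda>_def L_def)
      show "0 \<le> C" using C(1) by simp
      show "ln (6 * L) - 2 * ln Cmin \<le> min cK (1 / 2) * L"
        using elim by (simp only: L_def c_def)
      show "0 < \<epsilon>" by (rule \<epsilon>)
      show "0 \<le> ?r n" using M(1) by (intro mult_nonneg_nonneg) simp_all
      show "4 * (12 * (cK + C + 12 + 2) / min cK (1 / 2) + 6 + (cK + C + 12) + \<bar>ln (\<epsilon> / 2)\<bar>) *
          (real Ks * \<Lambda>) \<le> real n * (?r n)\<^sup>2"
        using \<rho>_ge unfolding Z_def C1_def c_def .
    qed
    finally show ?case .
  qed
  moreover have "(\<lambda>n. (8 + 2 / \<epsilon>) / real n) \<longlonglongrightarrow> 0"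
    by (rule lim_const_over_n)
  ultimately show "?p \<longlonglongrightarrow> 0"
    by (intro tendsto_sandwich[of "\<lambda>_. 0" ?p sequentially "\<lambda>n. (8 + 2 / \<epsilon>) / real n"]) simp_all
qed

end
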